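(* A function $f:\mathbb{N}\times\mathbb{N}\to\mathbb{N}$ is computable by a three counter machine in time bounded by a polynomial in the input values $x,y$ if and only if it is computable by a deterministic Turing machine in linear space, where the inputs and output of the Turing machine are encoded in binary.
   Context: A $k$ counter machine has $k$ counters, each storing a nonnegative integer, and is controlled by a finite deterministic sequential program built from four instruction types: Increment (add 1 to a specified counter); Conditional Decrement (if the specified counter is greater than 0, subtract 1; otherwise leave it unchanged and jump to a specified instruction); Unconditional Jump (transfer control to a specified instruction); Halt (stop). A three counter machine computes $f(x,y)$ if, started with $x$ in its first counter, $y$ in its second counter and $0$ in its third counter, it halts with $f(x,y)$ as the contents of a (designated) counter; its running time is the number of executed instructions, measured as a function of the values $x,y$ (inputs are effectively in unary). A deterministic Turing machine computes $f$ in linear space if, started with the binary representations of $x$ and $y$ (separated by a separator symbol) written on its work tape, it halts with the binary representation of $f(x,y)$ on its tape, using a number of tape cells linear in the length of the binary encoding of the input (i.e. it is a deterministic linear bounded automaton). *)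

theory Defs
  imports "HOL-Computational_Algebra.Polynomial"
begin

text \<open>
  Instructions are addressed by their position in the program, counters by \<open>0, \<dots>, k - 1\<close>.
  \<open>Dec i l\<close> jumps to \<open>l\<close> if counter \<open>i\<close> is 0 and otherwise decrements it.
\<close>

datatype instr = Inc nat | Dec nat nat | Jump nat | Halt

fun instr_ok :: "nat \<Rightarrow> nat \<Rightarrow> instr \<Rightarrow> bool" where
  "instr_ok k len (Inc i) \<longleftrightarrow> i < k"
| "instr_ok k len (Dec i l) \<longleftrightarrow> i < k \<and> l < len"
| "instr_ok k len (Jump l) \<longleftrightarrow> l < len"
| "instr_ok k len Halt \<longleftrightarrow> True"

definition counter_program :: "nat \<Rightarrow> instr list \<Rightarrow> bool" where
  "counter_program k P \<longleftrightarrow> (\<forall>ins \<in> set P. instr_ok k (length P) ins)"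

type_synonym cm_config = "nat \<times> nat list"

text \<open>
  Running past the last instruction leaves the machine stuck in a configuration that is not
  halted; halting means reaching a \<open>Halt\<close> instruction.
\<close>

inductive cm_step :: "instr list \<Rightarrow> cm_config \<Rightarrow> cm_config \<Rightarrow> bool" for P where
  inc: "pc < length P \<Longrightarrow> P ! pc = Inc i \<Longrightarrow>
    cm_step P (pc, v) (Suc pc, v[i := v ! i + 1])"
| dec: "pc < length P \<Longrightarrow> P ! pc = Dec i l \<Longrightarrow> v ! i > 0 \<Longrightarrow>
    cm_step P (pc, v) (Suc pc, v[i := v ! i - 1])"
| dec_zero: "pc < length P \<Longrightarrow> P ! pc = Dec i l \<Longrightarrow> v ! i = 0 \<Longrightarrow>
    cm_step P (pc, v) (l, v)"
| jump: "pc < length P \<Longrightarrow> P ! pc = Jump l \<Longrightarrow>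
    cm_step P (pc, v) (l, v)"

definition cm_halted :: "instr list \<Rightarrow> cm_config \<Rightarrow> bool" where
  "cm_halted P c \<longleftrightarrow> fst c < length P \<and> P ! fst c = Halt"

text \<open>The final \<open>Halt\<close> counts as an executed instruction, hence the \<open>Suc\<close>.\<close>

definition cm_halts_in :: "instr list \<Rightarrow> cm_config \<Rightarrow> nat \<Rightarrow> cm_config \<Rightarrow> bool" where
  "cm_halts_in P c t c' \<longleftrightarrow> (\<exists>n. t = Suc n \<and> (cm_step P ^^ n) c c' \<and> cm_halted P c')"

text \<open>
  The output counter \<open>r\<close> is fixed together with the program.  The bivariate polynomial \<open>p\<close> is
  read as a polynomial in \<open>y\<close> whose coefficients are polynomials in \<open>x\<close>.
\<close>

definition three_counter_polytime :: "(nat \<times> nat \<Rightarrow> nat) \<Rightarrow> bool" where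
  "three_counter_polytime f \<longleftrightarrow>
    (\<exists>P r. \<exists>p :: real poly poly. counter_program 3 P \<and> r < 3 \<and>
      (\<forall>x y. \<exists>t pc v. cm_halts_in P (0, [x, y, 0]) t (pc, v) \<and>
        v ! r = f (x, y) \<and>
        real t \<le> poly (poly p [:real y:]) (real x)))"

text \<open>
  A deterministic machine with a single two-way infinite tape.  States are natural numbers and
  work symbols beyond the input alphabet are \<open>Aux n\<close>; since every machine uses only finitely
  many of each, this is no restriction.
\<close>

datatype symbol = Blank | Digit bool | Sep | Aux nat

datatype move = MLeft | MStay | MRight

record tm =
  tm_states :: "nat set"
  tm_symbols :: "symbol set"
  tm_start :: nat
  tm_halt :: nat
  tm_delta :: "nat \<Rightarrow> symbol \<Rightarrow> nat \<times> symbol \<times> move"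

definition turing_machine :: "tm \<Rightarrow> bool" where
  "turing_machine M \<longleftrightarrow>
    finite (tm_states M) \<and> finite (tm_symbols M) \<and>
    {Blank, Digit False, Digit True, Sep} \<subseteq> tm_symbols M \<and>
    tm_start M \<in> tm_states M \<and> tm_halt M \<in> tm_states M \<and>
    (\<forall>q \<in> tm_states M. \<forall>a \<in> tm_symbols M.
      case tm_delta M q a of (q', b, d) \<Rightarrow> q' \<in> tm_states M \<and> b \<in> tm_symbols M)"

fun move_head :: "move \<Rightarrow> int \<Rightarrow> int" where
  "move_head MLeft h = h - 1"
| "move_head MStay h = h"
| "move_head MRight h = h + 1"

text \<open>State, tape contents, head position.\<close>

type_synonym tm_config = "nat \<times> (int \<Rightarrow> symbol) \<times> int"

inductive tm_step :: "tm \<Rightarrow> tm_config \<Rightarrow> tm_config \<Rightarrow> bool" for M where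
  "q \<noteq> tm_halt M \<Longrightarrow> tm_delta M q (tape h) = (q', b, d) \<Longrightarrow>
    tm_step M (q, tape, h) (q', tape(h := b), move_head d h)"

definition tape_of :: "int \<Rightarrow> symbol list \<Rightarrow> int \<Rightarrow> symbol" where
  "tape_of s w = (\<lambda>i. if s \<le> i \<and> i < s + int (length w) then w ! nat (i - s) else Blank)"

definition tm_init :: "tm \<Rightarrow> symbol list \<Rightarrow> tm_config" where
  "tm_init M w = (tm_start M, tape_of 0 w, 0)"

definition tm_cells :: "tm \<Rightarrow> symbol list \<Rightarrow> int set" where
  "tm_cells M w = {0..<int (length w)} \<union>
    {h. \<exists>q tape. (tm_step M)\<^sup>*\<^sup>* (tm_init M w) (q, tape, h)}"

text \<open>Most significant digit first, no leading zeros; 0 is represented by the single digit 0.\<close>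

fun binary :: "nat \<Rightarrow> symbol list" where
  "binary n = (if n < 2 then [Digit (n = 1)] else binary (n div 2) @ [Digit (odd n)])"

declare binary.simps [simp del]

definition tm_input :: "nat \<Rightarrow> nat \<Rightarrow> symbol list" where
  "tm_input x y = binary x @ [Sep] @ binary y"

text \<open>The output may be located anywhere on the otherwise blank tape.\<close>

definition tm_outputs :: "tm \<Rightarrow> symbol list \<Rightarrow> symbol list \<Rightarrow> bool" where
  "tm_outputs M w u \<longleftrightarrow>
    (\<exists>s h. (tm_step M)\<^sup>*\<^sup>* (tm_init M w) (tm_halt M, tape_of s u, h))"

definition linear_space_computable :: "(nat \<times> nat \<Rightarrow> nat) \<Rightarrow> bool" where
  "linear_space_computable f \<longleftrightarrow>
    (\<exists>M c. turing_machine M \<and>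
      (\<forall>x y. tm_outputs M (tm_input x y) (binary (f (x, y))) \<and>
        finite (tm_cells M (tm_input x y)) \<and>
        card (tm_cells M (tm_input x y)) \<le> c * length (tm_input x y)))"

end

(*
  From Turing machines to counters: the tape to the left and to the right of the head is kept as two
  numbers in base b, and the third counter serves to multiply and divide by constants.  With linearly
  many cells these numbers are polynomial in x and y.  The running time comes for free: a deterministic
  halting run repeats no configuration, and there are only polynomially many.

  From counters to Turing machines: in polynomial time the counters stay polynomially bounded, so their
  binary representations have linear length.  They live on three parallel tracks, and the machine
  increments and decrements them by propagating carries and borrows.
*)

theory Submission
  imports Defs "HOL-Library.Countable"
begin

section \<open>Compiling labelled counter machines\<close>

text \<open>The obstacle is to chain many small loops without tracking step counts or intermediate
  configurations. Three inductive halting predicates (\<open>lhalts\<close>, \<open>halts\<close>,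
  \<open>crun\<close>) therefore grow from the end of a run and carry a resource bound along: a
  bound on the registers, or an interval for the head. A lemma on a routine assumes that the rest of
  the run succeeds from the configuration that the routine leaves behind, and routines are chained
  by applying such lemmas in reverse order. The register bound is \<open>b ^ (2 * N + 2)\<close>,
  the size of half a tape in base \<open>b\<close>; it is polynomial because 2 to the length of the
  input is at most \<open>8 * (Suc x * Suc y)\<close>. In the other direction the delicate operation
  is the zero test: no single cell shows that a counter is 0, so this is found out by a borrow that
  meets no 1 bit and must then be undone.\<close>

datatype 'l lop = LInc nat 'l | LDec nat 'l 'l | LGoto 'l | LHalt

fun lop_ok :: "'l set \<Rightarrow> 'l lop \<Rightarrow> bool" where
  "lop_ok Q (LInc i p) \<longleftrightarrow> i < 3 \<and> p \<in> Q"
| "lop_ok Q (LDec i p q) \<longleftrightarrow> i < 3 \<and> p \<in> Q \<and> q \<in> Q"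
| "lop_ok Q (LGoto p) \<longleftrightarrow> p \<in> Q"
| "lop_ok Q LHalt \<longleftrightarrow> True"

text \<open>The bound \<open>B\<close> on all registers is what later yields a bound on the running time.\<close>

inductive lhalts :: "('l \<Rightarrow> 'l lop) \<Rightarrow> nat \<Rightarrow> 'l \<Rightarrow> (nat \<Rightarrow> nat) \<Rightarrow> nat \<Rightarrow> bool" for op B where
  lhalts_halt: "op l = LHalt \<Longrightarrow> \<forall>k. r k \<le> B \<Longrightarrow> lhalts op B l r (r 0)"
| lhalts_inc: "op l = LInc i p \<Longrightarrow> \<forall>k. r k \<le> B \<Longrightarrow> lhalts op B p (r(i := Suc (r i))) v \<Longrightarrow> lhalts op B l r v"
| lhalts_dec: "op l = LDec i p q \<Longrightarrow> \<forall>k. r k \<le> B \<Longrightarrow> r i > 0 \<Longrightarrow> lhalts op B p (r(i := r i - 1)) v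
    \<Longrightarrow> lhalts op B l r v"
| lhalts_dec_zero: "op l = LDec i p q \<Longrightarrow> \<forall>k. r k \<le> B \<Longrightarrow> r i = 0 \<Longrightarrow> lhalts op B q r v \<Longrightarrow> lhalts op B l r v"
| lhalts_goto: "op l = LGoto p \<Longrightarrow> \<forall>k. r k \<le> B \<Longrightarrow> lhalts op B p r v \<Longrightarrow> lhalts op B l r v"

text \<open>A labelled operation names its successor, whereas \<open>Inc\<close> and a successful
  \<open>Dec\<close> fall through to the next address. Each label thus gets a pair of addresses, the
  second for a jump; padding with \<open>Halt\<close> keeps all pairs aligned at even
  addresses.\<close>

fun lop_instrs :: "('l \<Rightarrow> nat) \<Rightarrow> 'l lop \<Rightarrow> instr \<times> instr" where
  "lop_instrs a (LInc i p) = (Inc i, Jump (a p))"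
| "lop_instrs a (LDec i p q) = (Dec i (a q), Jump (a p))"
| "lop_instrs a (LGoto p) = (Jump (a p), Halt)"
| "lop_instrs a LHalt = (Halt, Halt)"

definition cm_box :: "instr list \<Rightarrow> nat \<Rightarrow> cm_config set" where
  "cm_box P B = {..<length P} \<times> {w. set w \<subseteq> {..B} \<and> length w = 3}"

lemma finite_cm_box: "finite (cm_box P B)"
  unfolding cm_box_def by (intro finite_cartesian_product finite_lists_length_eq) auto

lemma card_cm_box: "card (cm_box P B) = length P * Suc B ^ 3"
  unfolding cm_box_def by (simp add: card_cartesian_product card_lists_length_eq)

text \<open>A run inside a finite set of configurations can be shortened to one without repetitions;
  this replaces every explicit count of execution steps.\<close>

lemma cm_run_short:
  assumes "(c, c') \<in> {(c, c'). cm_step P c c' \<and> c \<in> cm_box P B \<and> c' \<in> cm_box P B}\<^sup>*"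
  shows "\<exists>n \<le> (length P * Suc B ^ 3)\<^sup>2. (cm_step P ^^ n) c c'"
proof -
  let ?S = "{(c, c'). cm_step P c c' \<and> c \<in> cm_box P B \<and> c' \<in> cm_box P B}"
  have sub: "?S \<subseteq> cm_box P B \<times> cm_box P B" by auto
  have fin: "finite ?S"
    using finite_subset[OF sub] finite_cm_box by blast
  \<comment> \<open>\<open>rtrancl_finite_eq_relpow\<close> bounds the length of a path by the
    number of pairs in the relation rather than by the number of configurations, hence the
    square.\<close>
  have card: "card ?S \<le> (length P * Suc B ^ 3)\<^sup>2"
    using card_mono[OF _ sub] finite_cm_box
    by (simp add: card_cartesian_product card_cm_box power2_eq_square)
  obtain n where n: "n \<le> card ?S" "(c, c') \<in> ?S ^^ n"
    using assms rtrancl_finite_eq_relpow[OF fin] by auto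
  have "(x, y) \<in> ?S ^^ n \<Longrightarrow> (cm_step P ^^ n) x y" for n x y
    by (induction n arbitrary: y) (auto simp: relcompp_apply)
  then show ?thesis using n card by (meson le_trans)
qed

text \<open>A labelled step becomes one or two machine steps. All their endpoints lie in
  \<open>cm_box P B\<close>, because \<open>lhalts\<close> demands the bound in every configuration,
  so the run is a path in a finite relation and \<open>cm_run_short\<close> supplies the step
  count.\<close>

lemma compile:
  fixes op :: "'l \<Rightarrow> 'l lop"
  assumes fin: "finite Q" and l0: "l0 \<in> Q" and ok: "\<And>l. l \<in> Q \<Longrightarrow> lop_ok Q (op l)"
  shows "\<exists>P. counter_program 3 P \<and> (\<forall>B r v. lhalts op B l0 r v \<longrightarrow>
    (\<exists>n pc w. n \<le> (length P * Suc B ^ 3)\<^sup>2 \<and> (cm_step P ^^ n) (0, [r 0, r 1, r 2]) (pc, w) \<and>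
      cm_halted P (pc, w) \<and> w ! 0 = v))"
proof -
  obtain ls0 where ls0: "set ls0 = Q" using fin finite_list by blast
  \<comment> \<open>The machine starts at address 0, so \<open>l0\<close> is put in front and
    \<open>idx l0\<close> is forced to be 0, although \<open>ls0\<close> lists \<open>l0\<close>
    once more.\<close>
  define ls where "ls = l0 # ls0"
  have ls: "set ls = Q" using ls0 l0 by (auto simp: ls_def)
  define idx where "idx l = (if l = l0 then 0 else SOME k. k < length ls \<and> ls ! k = l)" for l
  have idx: "idx l < length ls" "ls ! idx l = l" if "l \<in> Q" for l
  proof -
    have "\<exists>k. k < length ls \<and> ls ! k = l" using that ls by (metis in_set_conv_nth)
    from someI_ex[OF this] show "idx l < length ls" "ls ! idx l = l"
      by (auto simp: idx_def ls_def)
  qed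
  define a where "a l = 2 * idx l" for l
  define P where "P = map (\<lambda>n. (if even n then fst else snd) (lop_instrs a (op (ls ! (n div 2)))))
     [0..<2 * length ls]"
  have lenP: "length P = 2 * length ls" by (simp add: P_def)
  have aP: "a l < length P" "Suc (a l) < length P" if "l \<in> Q" for l
    using idx(1)[OF that] by (auto simp: a_def lenP)
  have Pa: "P ! a l = fst (lop_instrs a (op l))" "P ! Suc (a l) = snd (lop_instrs a (op l))"
    if "l \<in> Q" for l
    using idx[OF that] by (auto simp: P_def a_def)
  have instr: "instr_ok 3 (length P) (fst (lop_instrs a q)) \<and> instr_ok 3 (length P) (snd (lop_instrs a q))"
    if "lop_ok Q q" for q
    using that aP by (cases q) auto
  have "counter_program 3 P"
    unfolding counter_program_def
  proof
    fix ins assume "ins \<in> set P"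
    then obtain n where n: "n < 2 * length ls"
      "ins = (if even n then fst else snd) (lop_instrs a (op (ls ! (n div 2))))"
      by (auto simp: P_def)
    have "ls ! (n div 2) \<in> Q" using n(1) ls by (auto intro: nth_mem)
    then show "instr_ok 3 (length P) ins"
      using instr[OF ok] n(2) by auto
  qed
  moreover have "\<exists>n pc w. n \<le> (length P * Suc B ^ 3)\<^sup>2 \<and> (cm_step P ^^ n) (0, [r 0, r 1, r 2]) (pc, w) \<and>
      cm_halted P (pc, w) \<and> w ! 0 = v" if "lhalts op B l0 r v" for B r v
  proof -
    define S where "S = {(c, c'). cm_step P c c' \<and> c \<in> cm_box P B \<and> c' \<in> cm_box P B}"
    have bnd: "\<forall>k. r k \<le> B" if "lhalts op B l r v" for l r v
      using that by cases auto
    have box: "(n, [r 0, r 1, r 2]) \<in> cm_box P B" if "\<forall>k. r k \<le> B" "n < length P" for n and r :: "nat \<Rightarrow> nat"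
      using that by (auto simp: cm_box_def)
    have upd: "[r 0, r 1, r 2][i := z] = [(r(i := z)) 0, (r(i := z)) 1, (r(i := z)) 2]"
      if "i < 3" for i z and r :: "nat \<Rightarrow> nat"
    proof -
      have "i = 0 \<or> i = 1 \<or> i = 2" using that by auto
      then show ?thesis by auto
    qed
    have nth: "[r 0, r 1, r 2] ! i = r i" if "i < 3" for i and r :: "nat \<Rightarrow> nat"
    proof -
      have "i = 0 \<or> i = 1 \<or> i = 2" using that by auto
      then show ?thesis by auto
    qed
    have jump: "((Suc (a l), [r 0, r 1, r 2]), (a p, [r 0, r 1, r 2])) \<in> S"
      if "snd (lop_instrs a (op l)) = Jump (a p)" "l \<in> Q" "p \<in> Q" "\<forall>k. r k \<le> B"
      for l p and r :: "nat \<Rightarrow> nat"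
      using that box[OF that(4) aP(2)[OF that(2)]] box[OF that(4) aP(1)[OF that(3)]]
      unfolding S_def by (auto intro: cm_step.jump simp: aP Pa)
    have "l \<in> Q \<Longrightarrow> \<exists>c. ((a l, [r 0, r 1, r 2]), c) \<in> S\<^sup>* \<and> cm_halted P c \<and> snd c ! 0 = v"
      if "lhalts op B l r v" for l r v
      using that
    proof (induction rule: lhalts.induct)
      case (lhalts_halt l r)
      then show ?case
        by (intro exI[of _ "(a l, [r 0, r 1, r 2])"]) (simp add: cm_halted_def aP Pa)
    next
      case (lhalts_inc l i p r v)
      let ?r = "r(i := Suc (r i))"
      from lhalts_inc ok have i: "i < 3" "p \<in> Q" by fastforce+
      have b: "\<forall>k. ?r k \<le> B" using bnd[OF lhalts_inc.hyps(3)] .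
      have "cm_step P (a l, [r 0, r 1, r 2]) (Suc (a l), [r 0, r 1, r 2][i := [r 0, r 1, r 2] ! i + 1])"
        by (rule cm_step.inc) (use lhalts_inc aP Pa in auto)
      then have "((a l, [r 0, r 1, r 2]), (Suc (a l), [?r 0, ?r 1, ?r 2])) \<in> S"
        unfolding upd[OF i(1)] nth[OF i(1)] S_def
        using box[OF lhalts_inc.hyps(2) aP(1)[OF lhalts_inc.prems]] box[OF b aP(2)[OF lhalts_inc.prems]]
        by simp
      moreover have "((Suc (a l), [?r 0, ?r 1, ?r 2]), (a p, [?r 0, ?r 1, ?r 2])) \<in> S"
        by (rule jump) (use lhalts_inc i b in auto)
      ultimately show ?case using lhalts_inc.IH[OF i(2)]
        by (metis converse_rtrancl_into_rtrancl)
    next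
      case (lhalts_dec l i p q r v)
      let ?r = "r(i := r i - 1)"
      from lhalts_dec ok have i: "i < 3" "p \<in> Q" by fastforce+
      have b: "\<forall>k. ?r k \<le> B" using bnd[OF lhalts_dec.hyps(4)] .
      have "cm_step P (a l, [r 0, r 1, r 2]) (Suc (a l), [r 0, r 1, r 2][i := [r 0, r 1, r 2] ! i - 1])"
        by (rule cm_step.dec) (use lhalts_dec aP Pa nth[OF i(1)] in auto)
      then have "((a l, [r 0, r 1, r 2]), (Suc (a l), [?r 0, ?r 1, ?r 2])) \<in> S"
        unfolding upd[OF i(1)] nth[OF i(1)] S_def
        using box[OF lhalts_dec.hyps(2) aP(1)[OF lhalts_dec.prems]] box[OF b aP(2)[OF lhalts_dec.prems]]
        by simp
      moreover have "((Suc (a l), [?r 0, ?r 1, ?r 2]), (a p, [?r 0, ?r 1, ?r 2])) \<in> S"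
        by (rule jump) (use lhalts_dec i b in auto)
      ultimately show ?case using lhalts_dec.IH[OF i(2)]
        by (metis converse_rtrancl_into_rtrancl)
    next
      case (lhalts_dec_zero l i p q r v)
      from lhalts_dec_zero ok have i: "i < 3" "q \<in> Q" by fastforce+
      have "cm_step P (a l, [r 0, r 1, r 2]) (a q, [r 0, r 1, r 2])"
        by (rule cm_step.dec_zero) (use lhalts_dec_zero aP Pa nth[OF i(1)] in auto)
      then have "((a l, [r 0, r 1, r 2]), (a q, [r 0, r 1, r 2])) \<in> S"
        unfolding S_def using box[OF lhalts_dec_zero.hyps(2)] aP lhalts_dec_zero.prems i(2) by simp
      then show ?case using lhalts_dec_zero.IH[OF i(2)]
        by (metis converse_rtrancl_into_rtrancl)
    next
      case (lhalts_goto l p r v)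
      from lhalts_goto ok have i: "p \<in> Q" by fastforce+
      have "cm_step P (a l, [r 0, r 1, r 2]) (a p, [r 0, r 1, r 2])"
        by (rule cm_step.jump) (use lhalts_goto aP Pa in auto)
      then have "((a l, [r 0, r 1, r 2]), (a p, [r 0, r 1, r 2])) \<in> S"
        unfolding S_def using box[OF lhalts_goto.hyps(2)] aP lhalts_goto.prems i by simp
      then show ?case using lhalts_goto.IH[OF i]
        by (metis converse_rtrancl_into_rtrancl)
    qed
    from this[OF that l0] obtain c where c: "((a l0, [r 0, r 1, r 2]), c) \<in> S\<^sup>*" "cm_halted P c" "snd c ! 0 = v"
      by auto
    have "a l0 = 0" by (simp add: a_def idx_def)
    with c cm_run_short[of "(a l0, [r 0, r 1, r 2])" c P B] show ?thesis
      unfolding S_def by (cases c) auto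
  qed
  ultimately show ?thesis by blast
qed

section \<open>Programs with multiplication and division by constants\<close>

text \<open>Code in continuation form: each operation contains the code that follows it.
  \<open>Pop\<close> chooses its continuation by the remainder, so a popped digit is remembered by
  the control and occupies no register. Loops arise only through \<open>Goto\<close>.\<close>

datatype 's prog = Push nat nat nat "'s prog" | Pop nat nat "nat \<Rightarrow> 's prog"
  | IfPos nat "'s prog" "'s prog" | Goto 's | Stop

text \<open>Programs address registers 0 and 1 only; register 2 is the scratch space that the compiled code
  needs for multiplication and division.\<close>

inductive halts :: "('s \<Rightarrow> 's prog) \<Rightarrow> nat \<Rightarrow> 's prog \<Rightarrow> (nat \<Rightarrow> nat) \<Rightarrow> nat \<Rightarrow> bool" for body B where
  halts_push: "m * r i + d \<le> B \<Longrightarrow> halts body B p (r(i := m * r i + d)) v \<Longrightarrow> halts body B (Push i m d p) r v"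
| halts_pop: "halts body B (g (r i mod m)) (r(i := r i div m)) v \<Longrightarrow> halts body B (Pop i m g) r v"
| halts_if_pos: "r i > 0 \<Longrightarrow> halts body B p r v \<Longrightarrow> halts body B (IfPos i p q) r v"
| halts_if_zero: "r i = 0 \<Longrightarrow> halts body B q r v \<Longrightarrow> halts body B (IfPos i p q) r v"
| halts_goto: "halts body B (body s) r v \<Longrightarrow> halts body B (Goto s) r v"
| halts_stop: "halts body B Stop r (r 0)"

lemma halts_Push_iff [simp]:
  "halts body B (Push i m d p) r v \<longleftrightarrow> m * r i + d \<le> B \<and> halts body B p (r(i := m * r i + d)) v"
  by (auto intro: halts_push elim: halts.cases)

lemma halts_Pop_iff [simp]:
  "halts body B (Pop i m g) r v \<longleftrightarrow> halts body B (g (r i mod m)) (r(i := r i div m)) v"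
  by (auto intro: halts_pop elim: halts.cases)

lemma halts_IfPos_iff [simp]:
  "halts body B (IfPos i p q) r v \<longleftrightarrow> halts body B (if r i > 0 then p else q) r v"
  by (auto intro: halts_if_pos halts_if_zero elim: halts.cases)

lemma halts_Goto_iff: "halts body B (Goto s) r v \<longleftrightarrow> halts body B (body s) r v"
  by (auto intro: halts_goto elim: halts.cases)

lemma halts_Stop_iff [simp]: "halts body B Stop r v \<longleftrightarrow> v = r 0"
  by (auto intro: halts_stop elim: halts.cases)

primrec prog_ok :: "'s set \<Rightarrow> 's prog \<Rightarrow> bool" where
  "prog_ok S (Push i m d p) \<longleftrightarrow> i < 2 \<and> prog_ok S p"
| "prog_ok S (Pop i m g) \<longleftrightarrow> i < 2 \<and> 0 < m \<and> (\<forall>j<m. prog_ok S (g j))"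
| "prog_ok S (IfPos i p q) \<longleftrightarrow> i < 2 \<and> prog_ok S p \<and> prog_ok S q"
| "prog_ok S (Goto s) \<longleftrightarrow> s \<in> S"
| "prog_ok S Stop \<longleftrightarrow> True"

text \<open>The remaining program text serves as its own address. It is refined by a phase and by a
  small number, which counts increments already made or holds the remainder found so far.\<close>

type_synonym 's label = "'s prog \<times> nat \<times> nat"

text \<open>\<open>Push\<close>: phases 0 and 1 trade each unit of register \<open>i\<close> for
  \<open>m\<close> units of register 2, phases 2 and 3 move these back, phase 4 adds
  \<open>d\<close>. \<open>Pop\<close>: phase 0 counts the units of register \<open>i\<close> modulo
  \<open>m\<close> in the label, phase 1 records a full cycle in register 2, phases 2 and 3 move the
  quotient back while the label still holds the remainder. \<open>IfPos\<close> tests by a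
  decrement, which phase 1 repairs.\<close>

fun label_op :: "('s \<Rightarrow> 's prog) \<Rightarrow> 's label \<Rightarrow> 's label lop" where
  "label_op body (Push i m d p, k, j) =
    (if k = 0 then LDec i (Push i m d p, 1, 0) (Push i m d p, 2, 0)
     else if k = 1 then (if j < m then LInc 2 (Push i m d p, 1, Suc j) else LGoto (Push i m d p, 0, 0))
     else if k = 2 then LDec 2 (Push i m d p, 3, 0) (Push i m d p, 4, 0)
     else if k = 3 then LInc i (Push i m d p, 2, 0)
     else if j < d then LInc i (Push i m d p, 4, Suc j) else LGoto (p, 0, 0))"
| "label_op body (Pop i m g, k, j) =
    (if k = 0 then LDec i (if Suc j < m then (Pop i m g, 0, Suc j) else (Pop i m g, 1, 0)) (Pop i m g, 2, j)
     else if k = 1 then LInc 2 (Pop i m g, 0, 0)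
     else if k = 2 then LDec 2 (Pop i m g, 3, j) (g j, 0, 0)
     else LInc i (Pop i m g, 2, j))"
| "label_op body (IfPos i p q, k, j) =
    (if k = 0 then LDec i (IfPos i p q, 1, 0) (q, 0, 0) else LInc i (p, 0, 0))"
| "label_op body (Goto s, k, j) = LGoto (body s, 0, 0)"
| "label_op body (Stop, k, j) = LHalt"

text \<open>A generous superset of the labels that the code reaches. \<open>Goto s\<close>
  contributes only itself, which keeps the set finite in spite of loops; the bodies enter through a
  union over the control states.\<close>

primrec labels :: "'s prog \<Rightarrow> 's label set" where
  "labels (Push i m d p) = {Push i m d p} \<times> {..4} \<times> {..m + d} \<union> labels p"
| "labels (Pop i m g) = {Pop i m g} \<times> {..4} \<times> {..<m} \<union> (\<Union>j<m. labels (g j))"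
| "labels (IfPos i p q) = {IfPos i p q} \<times> {..4} \<times> {0} \<union> labels p \<union> labels q"
| "labels (Goto s) = {(Goto s, 0, 0)}"
| "labels Stop = {(Stop, 0, 0)}"

lemma finite_labels: "finite (labels p)"
  by (induction p) auto

lemma label_self: "prog_ok S p \<Longrightarrow> (p, 0, 0) \<in> labels p"
  by (cases p) auto

lemma lop_ok_mono: "lop_ok Q q \<Longrightarrow> Q \<subseteq> Q' \<Longrightarrow> lop_ok Q' q"
  by (cases q) auto

lemma label_op_ok:
  assumes "\<And>s. s \<in> S \<Longrightarrow> prog_ok S (body s)"
  shows "prog_ok S p \<Longrightarrow> l \<in> labels p \<Longrightarrow> lop_ok (labels p \<union> (\<Union>s\<in>S. labels (body s))) (label_op body l)"
proof (induction p)
  case (Push i m d p)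
  show ?case
  proof (cases "l \<in> labels p")
    case True
    then show ?thesis using Push by (auto elim!: lop_ok_mono)
  next
    case False
    with Push.prems obtain k j where "l = (Push i m d p, k, j)" "k \<le> 4" "j \<le> m + d"
      by auto
    then show ?thesis using Push.prems label_self[of S p] by auto
  qed
next
  case (Pop i m g)
  show ?case
  proof (cases "\<exists>j<m. l \<in> labels (g j)")
    case True
    then obtain j where j: "j < m" "l \<in> labels (g j)" by auto
    have "lop_ok (labels (g j) \<union> (\<Union>s\<in>S. labels (body s))) (label_op body l)"
      using Pop.IH[of "g j"] Pop.prems j by auto
    then show ?thesis by (rule lop_ok_mono) (use j in auto)
  next
    case False
    with Pop.prems obtain k j where "l = (Pop i m g, k, j)" "k \<le> 4" "j < m"
      by auto
    moreover then have "(g j, 0, 0) \<in> labels (g j)" using Pop.prems label_self by auto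
    ultimately show ?thesis using Pop.prems by auto
  qed
next
  case (IfPos i p q)
  show ?case
  proof (cases "l \<in> labels p \<or> l \<in> labels q")
    case True
    then show ?thesis using IfPos by (auto elim!: lop_ok_mono)
  next
    case False
    then show ?thesis using IfPos.prems label_self[of S p] label_self[of S q] by auto
  qed
next
  case (Goto s)
  then show ?case using assms label_self by fastforce
qed auto

text \<open>The phases are treated from the last to the first. In the multiplication loop
  \<open>s 2 + m * s i\<close> is constant, so no intermediate value exceeds what the bounds on the
  old and the new contents allow.\<close>

lemma lhalts_push:
  assumes L: "L = Push i m d p" and i: "i < 2" and r2: "r 2 = 0" and B: "\<forall>k. r k \<le> B"
    and mB: "m * r i + d \<le> B"
    and cont: "lhalts (label_op body) B (p, 0, 0) (r(i := m * r i + d)) v"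
  shows "lhalts (label_op body) B (L, 0, 0) r v"
proof -
  let ?H = "lhalts (label_op body) B"
  have p4: "?H (L, 4, j) s v"
    if "?H (p, 0, 0) (s(i := s i + (d - j))) v" "j \<le> d" "\<forall>k. s k \<le> B" "s i + (d - j) \<le> B" for j s
    using that
  proof (induction "d - j" arbitrary: j s)
    case 0
    then show ?case by (rule_tac lhalts_goto[of _ _ "(p, 0, 0)"]) (auto simp: L)
  next
    case (Suc n)
    let ?s = "s(i := Suc (s i))"
    have "?H (L, 4, Suc j) ?s v"
      using Suc.prems Suc.hyps(2) by (intro Suc.hyps(1)) (auto simp: Suc_diff_Suc)
    then show ?case using Suc.hyps(2) Suc.prems by (rule_tac lhalts_inc[of _ _ i "(L, 4, Suc j)"]) (auto simp: L)
  qed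
  have p2: "?H (L, 2, 0) s v"
    if "?H (L, 4, 0) (s(i := s i + s 2, 2 := 0)) v" "\<forall>k. s k \<le> B" "s i + s 2 \<le> B" for s
    using that
  proof (induction "s 2" arbitrary: s)
    case 0
    then have "s(i := s i + s 2, 2 := 0) = s" using i by (auto simp: fun_eq_iff)
    with 0(2) have "?H (L, 4, 0) s v" by (simp only:)
    with 0 show ?case by (rule_tac lhalts_dec_zero[of _ _ 2 "(L, 3, 0)" "(L, 4, 0)"]) (auto simp: L)
  next
    case (Suc n)
    let ?t = "s(2 := s 2 - 1)"
    let ?s = "?t(i := Suc (?t i))"
    have eq: "?s(i := ?s i + ?s 2, 2 := 0) = s(i := s i + s 2, 2 := 0)"
      using Suc.hyps(2) i by (auto simp: fun_eq_iff)
    have "?H (L, 2, 0) ?s v"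
      by (rule Suc.hyps(1)) (use Suc.prems Suc.hyps(2) i in \<open>auto simp: eq le_diff_conv intro: le_trans[OF diff_le_self]\<close>)
    then have "?H (L, 3, 0) ?t v"
      using Suc.prems by (rule_tac lhalts_inc[of _ _ i "(L, 2, 0)"]) (auto simp: L intro: le_trans[OF diff_le_self])
    then show ?case
      using Suc.prems Suc.hyps(2) by (rule_tac lhalts_dec[of _ _ 2 "(L, 3, 0)" "(L, 4, 0)"]) (auto simp: L)
  qed
  have p1: "?H (L, 1, j) s v"
    if "?H (L, 0, 0) (s(2 := s 2 + (m - j))) v" "j \<le> m" "\<forall>k. s k \<le> B" "s 2 + (m - j) \<le> B" for j s
    using that
  proof (induction "m - j" arbitrary: j s)
    case 0
    then show ?case by (rule_tac lhalts_goto[of _ _ "(L, 0, 0)"]) (auto simp: L)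
  next
    case (Suc n)
    let ?s = "s(2 := Suc (s 2))"
    have "?H (L, 1, Suc j) ?s v"
      using Suc.prems Suc.hyps(2) by (intro Suc.hyps(1)) (auto simp: Suc_diff_Suc)
    then show ?case using Suc.hyps(2) Suc.prems by (rule_tac lhalts_inc[of _ _ 2 "(L, 1, Suc j)"]) (auto simp: L)
  qed
  have p0: "?H (L, 0, 0) s v"
    if "?H (L, 2, 0) (s(i := 0, 2 := s 2 + m * s i)) v" "\<forall>k. s k \<le> B" "s 2 + m * s i \<le> B" for s
    using that
  proof (induction "s i" arbitrary: s)
    case 0
    then have "s(i := 0, 2 := s 2 + m * s i) = s" by (auto simp: fun_eq_iff)
    with 0(2) have "?H (L, 2, 0) s v" by (simp only:)
    with 0 show ?case by (rule_tac lhalts_dec_zero[of _ _ i "(L, 1, 0)" "(L, 2, 0)"]) (auto simp: L)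
  next
    case (Suc n)
    let ?t = "s(i := s i - 1)"
    let ?s = "?t(2 := ?t 2 + m)"
    have le: "s 2 + m + m * (s i - 1) = s 2 + m * s i"
      using Suc.hyps(2) by (cases "s i") auto
    have eq: "?s(i := 0, 2 := ?s 2 + m * ?s i) = s(i := 0, 2 := s 2 + m * s i)"
      using le i by (auto simp: fun_eq_iff)
    have b: "\<forall>k. ?t k \<le> B" using Suc.prems by (auto intro: le_trans[OF diff_le_self])
    have b2: "s 2 + m \<le> B" using le Suc.prems(2,3) by (metis le_add1 le_trans)
    have h: "?H (L, 2, 0) (?s(i := 0, 2 := ?s 2 + m * ?s i)) v"
      unfolding eq by (rule Suc.prems(1))
    have s: "\<forall>k. ?s k \<le> B" "?s 2 + m * ?s i \<le> B" "n = ?s i"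
      using Suc.prems(2,3) Suc.hyps(2) b b2 le i by auto
    have "?H (L, 0, 0) ?s v"
      by (rule Suc.hyps(1)[OF s(3) h s(1,2)])
    then have "?H (L, 1, 0) ?t v"
      using b b2 i by (intro p1) auto
    then show ?case
      using Suc.prems Suc.hyps(2) by (rule_tac lhalts_dec[of _ _ i "(L, 1, 0)" "(L, 2, 0)"]) (auto simp: L)
  qed
  let ?s = "r(i := m * r i)"
  have "?H (L, 4, 0) ?s v"
    using cont B mB by (intro p4) auto
  moreover have "(\<lambda>s. s(i := s i + s 2, 2 := 0)) (r(i := 0, 2 := r 2 + m * r i)) = ?s"
    using r2 i by (auto simp: fun_eq_iff)
  ultimately have "?H (L, 2, 0) (r(i := 0, 2 := r 2 + m * r i)) v"
    using r2 B mB i by (intro p2) (auto simp: fun_upd_def)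
  then show ?thesis
    using r2 B mB by (intro p0) auto
qed

text \<open>While phase 0 runs with remainder \<open>j\<close>, the number
  \<open>m * s 2 + j + s i\<close> is constant and \<open>s 2 + s i\<close> does not grow.\<close>

lemma lhalts_pop:
  assumes L: "L = Pop i m g" and i: "i < 2" and m: "0 < m" and r2: "r 2 = 0" and B: "\<forall>k. r k \<le> B"
    and cont: "lhalts (label_op body) B (g (r i mod m), 0, 0) (r(i := r i div m)) v"
  shows "lhalts (label_op body) B (L, 0, 0) r v"
proof -
  let ?H = "lhalts (label_op body) B"
  have p2: "?H (L, 2, j) s v"
    if "?H (g j, 0, 0) (s(i := s i + s 2, 2 := 0)) v" "\<forall>k. s k \<le> B" "s i + s 2 \<le> B" for s j
    using that
  proof (induction "s 2" arbitrary: s)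
    case 0
    then have "s(i := s i + s 2, 2 := 0) = s" using i by (auto simp: fun_eq_iff)
    with 0(2) have "?H (g j, 0, 0) s v" by (simp only:)
    with 0 show ?case by (rule_tac lhalts_dec_zero[of _ _ 2 "(L, 3, j)" "(g j, 0, 0)"]) (auto simp: L)
  next
    case (Suc n)
    let ?t = "s(2 := s 2 - 1)"
    let ?s = "?t(i := Suc (?t i))"
    have eq: "?s(i := ?s i + ?s 2, 2 := 0) = s(i := s i + s 2, 2 := 0)"
      using Suc.hyps(2) i by (auto simp: fun_eq_iff)
    have "?H (L, 2, j) ?s v"
      by (rule Suc.hyps(1)) (use Suc.prems Suc.hyps(2) i in \<open>auto simp: eq le_diff_conv intro: le_trans[OF diff_le_self]\<close>)
    then have "?H (L, 3, j) ?t v"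
      using Suc.prems by (rule_tac lhalts_inc[of _ _ i "(L, 2, j)"]) (auto simp: L intro: le_trans[OF diff_le_self])
    then show ?case
      using Suc.prems Suc.hyps(2) by (rule_tac lhalts_dec[of _ _ 2 "(L, 3, j)" "(g j, 0, 0)"]) (auto simp: L)
  qed
  have p0: "?H (L, 0, j) s v"
    if "?H (L, 2, (j + s i) mod m) (s(i := 0, 2 := s 2 + (j + s i) div m)) v" "j < m" "\<forall>k. s k \<le> B"
       "s 2 + s i \<le> B" for s j
    using that
  proof (induction "s i" arbitrary: s j)
    case 0
    then have "s(i := 0, 2 := s 2 + (j + s i) div m) = s" by (auto simp: fun_eq_iff)
    with 0(2) have "?H (L, 2, (j + s i) mod m) s v" by (simp only:)
    with 0 show ?case
      by (rule_tac lhalts_dec_zero[of _ _ i "if Suc j < m then (L, 0, Suc j) else (L, 1, 0)" "(L, 2, j)"]) (auto simp: L)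
  next
    case (Suc n)
    let ?t = "s(i := s i - 1)"
    have b: "\<forall>k. ?t k \<le> B" using Suc.prems by (auto intro: le_trans[OF diff_le_self])
    have "?H (if Suc j < m then (L, 0, Suc j) else (L, 1, 0)) ?t v"
    proof (cases "Suc j < m")
      case True
      have "Suc j + ?t i = j + s i" using Suc.hyps(2) by simp
      moreover have "?t(i := 0, 2 := ?t 2 + (j + s i) div m) = s(i := 0, 2 := s 2 + (j + s i) div m)"
        using i by (auto simp: fun_eq_iff)
      ultimately have "?H (L, 0, Suc j) ?t v"
        using True Suc.prems Suc.hyps(2) b i by (intro Suc.hyps(1)) auto
      with True show ?thesis by simp
    next
      case False
      let ?s = "?t(2 := Suc (?t 2))"
      \<comment> \<open>Here \<open>j\<close> is \<open>m - 1\<close>: the unit just removed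
        completes a cycle of \<open>m\<close> units, which is exchanged for one unit of register
        2.\<close>
      have j: "j + s i = m + (s i - 1)" using False Suc.prems(2) Suc.hyps(2) by linarith
      have e: "?s(i := 0, 2 := ?s 2 + (0 + ?s i) div m) = s(i := 0, 2 := s 2 + (j + s i) div m)"
        "(0 + ?s i) mod m = (j + s i) mod m"
        unfolding j using i m by (auto simp: fun_eq_iff)
      have h: "?H (L, 2, (0 + ?s i) mod m) (?s(i := 0, 2 := ?s 2 + (0 + ?s i) div m)) v"
        unfolding e by (rule Suc.prems(1))
      have s: "\<forall>k. ?s k \<le> B" "?s 2 + ?s i \<le> B" "n = ?s i"
        using Suc.prems(3,4) Suc.hyps(2) b i by auto
      have "?H (L, 0, 0) ?s v"
        by (rule Suc.hyps(1)[OF s(3) h m s(1,2)])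
      then have "?H (L, 1, 0) ?t v"
        using b by (rule_tac lhalts_inc[of _ _ 2 "(L, 0, 0)"]) (auto simp: L)
      with False show ?thesis by simp
    qed
    then show ?case
      using Suc.prems Suc.hyps(2)
      by (rule_tac lhalts_dec[of _ _ i "if Suc j < m then (L, 0, Suc j) else (L, 1, 0)" "(L, 2, j)"]) (auto simp: L)
  qed
  have b: "r i div m \<le> B" using B by (meson div_le_dividend le_trans)
  have "(\<lambda>s. s(i := s i + s 2, 2 := 0)) (r(i := 0, 2 := r 2 + r i div m)) = r(i := r i div m)"
    using r2 i by (auto simp: fun_eq_iff)
  then have "?H (L, 2, r i mod m) (r(i := 0, 2 := r 2 + r i div m)) v"
    using r2 B b i cont by (intro p2) (auto simp: fun_upd_def)
  then show ?thesis
    using r2 B m by (intro p0) auto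
qed

text \<open>\<open>halts\<close> checks the bound only at \<open>Push\<close>, the one operation
  that can enlarge a register; with the bound on the initial contents this gives the bound in every
  configuration. Register 2 is empty between any two operations.\<close>

lemma halts_imp_lhalts:
  assumes S: "\<And>s. s \<in> S \<Longrightarrow> prog_ok S (body s)"
  shows "halts body B p r v \<Longrightarrow> prog_ok S p \<Longrightarrow> r 2 = 0 \<Longrightarrow> \<forall>k. r k \<le> B \<Longrightarrow> lhalts (label_op body) B (p, 0, 0) r v"
proof (induction rule: halts.induct)
  case (halts_push m r i d p v)
  let ?r = "r(i := m * r i + d)"
  have "i < 2" "prog_ok S p" using halts_push.prems by auto
  moreover have "?r 2 = 0" "\<forall>k. ?r k \<le> B" using halts_push.prems halts_push.hyps by auto
  ultimately show ?case
    using halts_push.prems halts_push.hyps halts_push.IH by (rule_tac lhalts_push[OF refl])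
next
  case (halts_pop g r i m v)
  let ?r = "r(i := r i div m)"
  have "r i div m \<le> B" using halts_pop.prems by (meson div_le_dividend le_trans)
  then have "\<forall>k. ?r k \<le> B" "?r 2 = 0" using halts_pop.prems by auto
  moreover have "i < 2" "0 < m" "prog_ok S (g (r i mod m))" using halts_pop.prems by auto
  ultimately show ?case
    using halts_pop.prems halts_pop.IH by (rule_tac lhalts_pop[OF refl])
next
  case (halts_if_pos r i p v q)
  let ?r = "r(i := r i - 1)"
  have b: "\<forall>k. ?r k \<le> B" using halts_if_pos.prems by (auto intro: le_trans[OF diff_le_self])
  have "?r(i := Suc (?r i)) = r" using halts_if_pos by auto
  then have "lhalts (label_op body) B (IfPos i p q, 1, 0) ?r v"
    using halts_if_pos b by (rule_tac lhalts_inc[of _ _ i "(p, 0, 0)"]) auto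
  then show ?case using halts_if_pos
    by (rule_tac lhalts_dec[of _ _ i "(IfPos i p q, 1, 0)" "(q, 0, 0)"]) auto
next
  case (halts_if_zero r i q v p)
  then show ?case by (rule_tac lhalts_dec_zero[of _ _ i "(IfPos i p q, 1, 0)" "(q, 0, 0)"]) auto
next
  case (halts_goto s r v)
  then show ?case using S by (rule_tac lhalts_goto[of _ _ "(body s, 0, 0)"]) auto
next
  case (halts_stop r)
  then show ?case by (rule_tac lhalts_halt) auto
qed

theorem prog_compile:
  assumes fin: "finite S" and ok: "\<And>s. s \<in> S \<Longrightarrow> prog_ok S (body s)" and s0: "s0 \<in> S"
  shows "\<exists>P. counter_program 3 P \<and> (\<forall>B r v. halts body B (Goto s0) r v \<longrightarrow> r 2 = 0 \<longrightarrow> (\<forall>k. r k \<le> B) \<longrightarrow>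
    (\<exists>n pc w. n \<le> (length P * Suc B ^ 3)\<^sup>2 \<and> (cm_step P ^^ n) (0, [r 0, r 1, 0]) (pc, w) \<and>
      cm_halted P (pc, w) \<and> w ! 0 = v))"
proof -
  let ?Q = "\<Union>s\<in>S. labels (body s)"
  have "\<exists>P. counter_program 3 P \<and> (\<forall>B r v. lhalts (label_op body) B (body s0, 0, 0) r v \<longrightarrow>
    (\<exists>n pc w. n \<le> (length P * Suc B ^ 3)\<^sup>2 \<and> (cm_step P ^^ n) (0, [r 0, r 1, r 2]) (pc, w) \<and>
      cm_halted P (pc, w) \<and> w ! 0 = v))"
  proof (rule compile)
    show "finite ?Q" using fin finite_labels by auto
    show "(body s0, 0, 0) \<in> ?Q" using label_self ok s0 by auto
    fix l assume "l \<in> ?Q"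
    then obtain s where s: "s \<in> S" "l \<in> labels (body s)" by auto
    have "lop_ok (labels (body s) \<union> ?Q) (label_op body l)"
      using label_op_ok[of S body, OF ok ok[OF s(1)] s(2)] by blast
    moreover have "labels (body s) \<union> ?Q = ?Q" using s by auto
    ultimately show "lop_ok ?Q (label_op body l)" by simp
  qed
  then obtain P where P: "counter_program 3 P" "\<And>B r v. lhalts (label_op body) B (body s0, 0, 0) r v \<Longrightarrow>
    (\<exists>n pc w. n \<le> (length P * Suc B ^ 3)\<^sup>2 \<and> (cm_step P ^^ n) (0, [r 0, r 1, r 2]) (pc, w) \<and>
      cm_halted P (pc, w) \<and> w ! 0 = v)" by blast
  show ?thesis
  proof (intro exI[of _ P] conjI allI impI P(1))
    fix B r v assume h: "halts body B (Goto s0) r v" "r 2 = 0" "\<forall>k. r k \<le> B"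
    then have "lhalts (label_op body) B (body s0, 0, 0) r v"
      using halts_imp_lhalts[OF ok] ok s0 by (simp add: halts_Goto_iff)
    from P(2)[OF this] h(2) show "\<exists>n pc w. n \<le> (length P * Suc B ^ 3)\<^sup>2 \<and> (cm_step P ^^ n) (0, [r 0, r 1, 0]) (pc, w) \<and>
      cm_halted P (pc, w) \<and> w ! 0 = v" by simp
  qed
qed

section \<open>Simulating a Turing machine with two stacks\<close>

text \<open>\<open>Blank\<close> has code 0, so that popping an empty stack yields the unvisited
  tape. Both digits have nonzero codes, so a stack with a digit left on it is never 0.\<close>

fun symbol_code :: "symbol \<Rightarrow> nat" where
  "symbol_code Blank = 0"
| "symbol_code (Digit d) = (if d then 2 else 1)"
| "symbol_code Sep = 3"
| "symbol_code (Aux n) = n + 5"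

definition symbol_decode :: "nat \<Rightarrow> symbol" where
  "symbol_decode a = (if a = 0 then Blank else if a = 1 then Digit False else if a = 2 then Digit True
    else if a = 3 then Sep else Aux (a - 5))"

lemma symbol_decode_code [simp]: "symbol_decode (symbol_code s) = s"
  by (cases s) (auto simp: symbol_decode_def)

lemma symbol_code_eq_0_iff [simp]: "symbol_code s = 0 \<longleftrightarrow> s = Blank"
  by (cases s) auto

text \<open>The code 4 belongs to no symbol and serves as the bottom marker of a stack.\<close>

datatype ctl = Start | RdX | MvX | RdY | InsY nat | BackY | Rewind ctl | Sim nat | Output

definition regs :: "nat \<Rightarrow> nat \<Rightarrow> nat \<Rightarrow> nat" where
  "regs a b = (\<lambda>i. if i = 0 then a else if i = 1 then b else 0)"

lemma regs_simps [simp]: "regs a b 0 = a" "regs a b (Suc 0) = b" "regs a b 2 = 0"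
  "(regs a b)(0 := c) = regs c b" "(regs a b)(Suc 0 := c) = regs a c"
  by (auto simp: regs_def fun_eq_iff)

text \<open>\<open>RdX\<close> and \<open>RdY\<close> produce bits least significant first.  Moving the bits of \<open>x\<close> to the other
  stack reverses them as desired; with only two stacks the bits of \<open>y\<close> cannot be reversed once more, so
  \<open>InsY\<close> inserts each of them directly behind the separator.\<close>

fun sim_body :: "tm \<Rightarrow> nat \<Rightarrow> ctl \<Rightarrow> ctl prog" where
  "sim_body M b Start = Push 1 b 4 (Goto RdX)"
| "sim_body M b RdX = Pop 0 2 (\<lambda>d. Push 1 b (Suc d) (IfPos 0 (Goto RdX) (Goto MvX)))"
| "sim_body M b MvX = Pop 1 b (\<lambda>a. if a = 4 then Push 0 b 3 (Goto RdY) else Push 0 b a (Goto MvX))"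
| "sim_body M b RdY = Pop 1 2 (\<lambda>d. Push 1 b 4 (Goto (InsY d)))"
| "sim_body M b (InsY d) = Pop 0 b (\<lambda>a. if a = 3 then Push 0 b 3 (Push 0 b (Suc d) (Goto BackY))
     else Push 1 b a (Goto (InsY d)))"
| "sim_body M b BackY = Pop 1 b (\<lambda>a. if a = 4
     then IfPos 1 (Goto RdY) (Goto (Rewind (Sim (tm_start M)))) else Push 0 b a (Goto BackY))"
| "sim_body M b (Rewind s) = IfPos 0 (Pop 0 b (\<lambda>a. Push 1 b a (Goto (Rewind s)))) (Goto s)"
| "sim_body M b (Sim q) = (if q = tm_halt M then Goto (Rewind Output) else Pop 1 b (\<lambda>a.
     if symbol_decode a \<in> tm_symbols M then
       (case tm_delta M q (symbol_decode a) of (q', s, d) \<Rightarrow> (case d of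
          MRight \<Rightarrow> Push 0 b (symbol_code s) (Goto (Sim q'))
        | MStay \<Rightarrow> Push 1 b (symbol_code s) (Goto (Sim q'))
        | MLeft \<Rightarrow> Push 1 b (symbol_code s) (Pop 0 b (\<lambda>c. Push 1 b c (Goto (Sim q'))))))
     else Stop))"
| "sim_body M b Output = IfPos 1 (Pop 1 b (\<lambda>a. if a = 1 \<or> a = 2 then Push 0 2 (a - 1) (Goto Output)
     else Goto Output)) Stop"

text \<open>Horner's scheme, top of the stack first. The number \<open>y\<close> below the listed
  symbols need not be a stack: while the input is loaded it contains a counter value still to be
  read in base 2.\<close>

primrec stack :: "nat \<Rightarrow> nat list \<Rightarrow> nat \<Rightarrow> nat" where
  "stack b [] y = y"
| "stack b (a # as) y = b * stack b as y + a"

lemma stack_append: "stack b (xs @ ys) y = stack b xs (stack b ys y)"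
  by (induction xs) auto

lemma stack_ge: "0 < b \<Longrightarrow> y \<le> stack b xs y"
proof (induction xs)
  case (Cons a xs)
  then have "y \<le> stack b xs y" "stack b xs y \<le> b * stack b xs y + a" by (simp_all add: trans_le_add1)
  then show ?case by simp
qed simp

lemma stack_less: "\<forall>a\<in>set xs. a < b \<Longrightarrow> stack b xs y < b ^ length xs * Suc y"
proof (induction xs)
  case (Cons a xs)
  then have "b * Suc (stack b xs y) \<le> b * (b ^ length xs * Suc y)" by (intro mult_le_mono) (use Cons in auto)
  moreover have "a < b" using Cons.prems by simp
  ultimately show ?case by (simp add: algebra_simps)
qed simp

section \<open>Binary numerals\<close>

lemma binary_less_2: "n < 2 \<Longrightarrow> binary n = [Digit (odd n)]"
  by (subst binary.simps) (auto simp: less_2_cases_iff)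

lemma binary_ge_2: "\<not> n < 2 \<Longrightarrow> binary n = binary (n div 2) @ [Digit (odd n)]"
  by (subst binary.simps) auto

lemma binary_neq_Nil [simp]: "binary n \<noteq> []"
  by (subst binary.simps) auto

lemma set_binary: "set (binary n) \<subseteq> range Digit"
proof (induction n rule: less_induct)
  case (less n)
  then show ?case by (cases "n < 2") (auto simp: binary_less_2 binary_ge_2 dest: less[of "n div 2"])
qed

lemma length_binary_le: "2 ^ length (binary n) \<le> 2 * max 1 n"
proof (induction n rule: less_induct)
  case (less n)
  show ?case
  proof (cases "n < 2")
    case False
    with less[of "n div 2"] have "2 ^ length (binary (n div 2)) \<le> 2 * (n div 2)" by simp
    with False show ?thesis by (auto simp: binary_ge_2)
  qed (simp add: binary_less_2)
qed

lemma less_power_length_binary: "n < 2 ^ length (binary n)"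
proof (induction n rule: less_induct)
  case (less n)
  show ?case
  proof (cases "n < 2")
    case False
    with less[of "n div 2"] have "n div 2 < 2 ^ length (binary (n div 2))" by simp
    with False show ?thesis by (auto simp: binary_ge_2)
  qed (simp add: binary_less_2)
qed

text \<open>The accumulator follows register 0 during \<open>Output\<close>, which likewise skips
  every symbol that is not a digit.\<close>

fun digits_val :: "nat \<Rightarrow> symbol list \<Rightarrow> nat" where
  "digits_val v [] = v"
| "digits_val v (Digit d # w) = digits_val (2 * v + of_bool d) w"
| "digits_val v (_ # w) = digits_val v w"

lemma digits_val_append: "digits_val v (u @ w) = digits_val (digits_val v u) w"
  by (induction v u rule: digits_val.induct) auto

lemma digits_val_binary: "digits_val 0 (binary n) = n"
proof (induction n rule: less_induct)
  case (less n)
  show ?case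
  proof (cases "n < 2")
    case True
    then show ?thesis by (auto simp: binary_less_2 less_2_cases_iff)
  next
    case False
    with less[of "n div 2"] show ?thesis
      by (auto simp: binary_ge_2 digits_val_append)
  qed
qed

lemma digits_val_less: "digits_val v w < 2 ^ length w * Suc v"
proof (induction v w rule: digits_val.induct)
  case (2 v d w)
  have "2 ^ length w * Suc (2 * v + of_bool d) \<le> 2 ^ length w * (2 * Suc v)"
    by (intro mult_le_mono) auto
  with 2 show ?case by simp
qed (auto intro: less_le_trans)

section \<open>The simulating program\<close>

text \<open>Base \<open>b\<close> exceeds all symbol codes, and \<open>5 \<le> b\<close> makes the
  bottom marker 4 a digit as well.\<close>

locale tm_sim =
  fixes M :: tm and b :: nat
  assumes tm: "turing_machine M"
    and code_less: "\<And>s. s \<in> tm_symbols M \<Longrightarrow> symbol_code s < b"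
    and b5: "5 \<le> b"
begin

lemma delta_in:
  assumes "q \<in> tm_states M" "a \<in> tm_symbols M" "tm_delta M q a = (q', s, d)"
  shows "q' \<in> tm_states M" "s \<in> tm_symbols M"
  using tm assms unfolding turing_machine_def by fastforce+

abbreviation "hlt B s \<equiv> halts (sim_body M b) B (Goto s)"

definition ctls :: "ctl set" where
  "ctls = {Start, RdX, MvX, RdY, BackY, Rewind (Sim (tm_start M)), Rewind Output, Output} \<union>
     InsY ` {..<2} \<union> Sim ` tm_states M"

lemma finite_ctls: "finite ctls"
  using tm by (auto simp: ctls_def turing_machine_def)

text \<open>\<open>Pop\<close> must have a legal continuation for every remainder below
  \<open>b\<close>, including those that encode no symbol of \<open>M\<close>. This is why
  \<open>Sim\<close> tests membership in \<open>tm_symbols M\<close> before it consults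
  \<open>tm_delta\<close>.\<close>

lemma sim_body_ok:
  assumes "s \<in> ctls" shows "prog_ok ctls (sim_body M b s)"
proof -
  have st: "tm_start M \<in> tm_states M" using tm by (auto simp: turing_machine_def)
  consider "s \<in> {Start, RdX, MvX, RdY, BackY, Rewind (Sim (tm_start M)), Rewind Output, Output} \<union> InsY ` {..<2}"
    | q where "s = Sim q" "q \<in> tm_states M"
    using assms by (auto simp: ctls_def)
  then show ?thesis
  proof cases
    case 1
    then show ?thesis using b5 st by (auto simp: ctls_def)
  next
    case 2
    have "prog_ok ctls (case tm_delta M q a of (q', s, d) \<Rightarrow> (case d of
          MRight \<Rightarrow> Push 0 b (symbol_code s) (Goto (Sim q'))
        | MStay \<Rightarrow> Push 1 b (symbol_code s) (Goto (Sim q'))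
        | MLeft \<Rightarrow> Push 1 b (symbol_code s) (Pop 0 b (\<lambda>c. Push 1 b c (Goto (Sim q'))))))"
      if "a \<in> tm_symbols M" for a
      using delta_in(1)[OF 2(2) that] b5 by (auto simp: ctls_def split: prod.split move.split)
    moreover have "Rewind Output \<in> ctls" by (simp add: ctls_def)
    ultimately show ?thesis using 2 b5 by (auto simp del: One_nat_def)
  qed
qed

lemma pop [simp]:
  assumes "a < b" shows "(b * n + a) mod b = a" "(b * n + a) div b = n"
  using assms by auto

lemma le_mult_b: "n \<le> b * n" using b5 by simp

lemma digit_less: "a \<in> range Digit \<Longrightarrow> symbol_code a < b" "a \<in> range Digit \<Longrightarrow> symbol_code a \<noteq> 3"
  "a \<in> range Digit \<Longrightarrow> symbol_code a \<noteq> 4"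
  using b5 by (auto split: if_splits)

lemma code_odd: "symbol_code (Digit (odd z)) = Suc (z mod 2)"
  by (auto simp: mod2_eq_if)

lemma stack_le_append: "stack b ys y \<le> stack b (xs @ ys) y"
  using b5 by (auto simp: stack_append intro: stack_ge)

section \<open>Loading the input onto the stacks\<close>

text \<open>\<open>S\<close> consists of the bits already read. Each round moves the last bit of
  \<open>z\<close> to the front of \<open>S\<close>, so \<open>binary z @ S\<close> is invariant.
  The loop tests after pushing, so that 0 yields one digit, in accordance with
  \<open>binary\<close>.\<close>

lemma hlt_RdX:
  assumes "hlt B MvX (regs 0 (stack b (map symbol_code (binary z @ S)) Y)) v"
    and "stack b (map symbol_code (binary z @ S)) Y \<le> B"
  shows "hlt B RdX (regs z (stack b (map symbol_code S) Y)) v"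
  using assms
proof (induction z arbitrary: S rule: less_induct)
  case (less z)
  let ?S = "Digit (odd z) # S"
  have c: "b * stack b (map symbol_code S) Y + Suc (z mod 2) = stack b (map symbol_code ?S) Y"
    by (simp only: stack.simps list.map code_odd)
  show ?case
  proof (cases "z < 2")
    case True
    have "hlt B MvX (regs 0 (b * stack b (map symbol_code S) Y + Suc (z mod 2))) v"
      "b * stack b (map symbol_code S) Y + Suc (z mod 2) \<le> B"
      unfolding c using less.prems True by (simp_all only: binary_less_2 append.simps)
    with True show ?thesis by (simp add: halts_Goto_iff[of _ _ RdX])
  next
    case False
    have bin: "binary z @ S = binary (z div 2) @ ?S" using False by (simp add: binary_ge_2)
    have "stack b (map symbol_code ?S) Y \<le> stack b (map symbol_code (binary (z div 2) @ ?S)) Y"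
      using stack_le_append by (simp only: map_append)
    also have "\<dots> \<le> B" using less.prems(2) bin by metis
    finally have le: "stack b (map symbol_code ?S) Y \<le> B" .
    have "hlt B RdX (regs (z div 2) (stack b (map symbol_code ?S) Y)) v"
      by (rule less.IH) (use False less.prems bin in auto)
    then show ?thesis
      using False le unfolding c[symmetric] by (simp add: halts_Goto_iff[of _ _ RdX])
  qed
qed

text \<open>The least significant bit of \<open>x\<close> ends on top of the left stack, as for a
  head standing just right of \<open>x\<close>; on reaching the bottom marker, the separator is
  pushed on it.\<close>

lemma hlt_MvX:
  assumes "hlt B RdY (regs (b * stack b (rev (map symbol_code xs)) z + 3) y) v"
    and "b * stack b (rev (map symbol_code xs)) z + 3 \<le> B" "set xs \<subseteq> range Digit"
  shows "hlt B MvX (regs z (stack b (map symbol_code xs) (b * y + 4))) v"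
  using assms
proof (induction xs arbitrary: z)
  case Nil
  then show ?case using b5 by (simp add: halts_Goto_iff[of _ _ MvX])
next
  case (Cons a xs)
  have s: "stack b (rev (map symbol_code (a # xs))) z = stack b (rev (map symbol_code xs)) (b * z + symbol_code a)"
    by (simp add: stack_append)
  have "b * z + symbol_code a \<le> stack b (rev (map symbol_code xs)) (b * z + symbol_code a)"
    using b5 by (intro stack_ge) auto
  also have "\<dots> \<le> b * \<dots> + 3" using le_mult_b by (rule trans_le_add1)
  also have "\<dots> \<le> B" using Cons.prems(2) unfolding s .
  finally have le: "b * z + symbol_code a \<le> B" .
  have "hlt B MvX (regs (b * z + symbol_code a) (stack b (map symbol_code xs) (b * y + 4))) v"
    using Cons.prems unfolding s by (intro Cons.IH) auto
  then show ?case using Cons.prems(3) le digit_less[of a] by (simp add: halts_Goto_iff[of _ _ MvX])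
qed

lemma hlt_InsY:
  assumes "hlt B BackY (regs (b * (b * X + 3) + Suc d) (stack b (rev (map symbol_code xs)) w)) v"
    and "stack b (rev (map symbol_code xs)) w \<le> B" "b * (b * X + 3) + Suc d \<le> B" "set xs \<subseteq> range Digit"
  shows "hlt B (InsY d) (regs (stack b (map symbol_code xs) (b * X + 3)) w) v"
  using assms
proof (induction xs arbitrary: w)
  case Nil
  have "b * X + 3 \<le> b * (b * X + 3) + Suc d" using le_mult_b by (rule trans_le_add1)
  then have "b * X + 3 \<le> B" using Nil.prems(3) by simp
  with Nil show ?case using b5 by (simp add: halts_Goto_iff[of _ _ "InsY d"])
next
  case (Cons a xs)
  have s: "stack b (rev (map symbol_code (a # xs))) w = stack b (rev (map symbol_code xs)) (b * w + symbol_code a)"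
    by (simp add: stack_append)
  have "b * w + symbol_code a \<le> stack b (rev (map symbol_code xs)) (b * w + symbol_code a)"
    using b5 by (intro stack_ge) auto
  also have "\<dots> \<le> B" using Cons.prems(2) unfolding s .
  finally have le: "b * w + symbol_code a \<le> B" .
  have "hlt B (InsY d) (regs (stack b (map symbol_code xs) (b * X + 3)) (b * w + symbol_code a)) v"
    using Cons.prems unfolding s by (intro Cons.IH) auto
  then show ?case using Cons.prems(4) le digit_less[of a] by (simp add: halts_Goto_iff[of _ _ "InsY d"])
qed

lemma hlt_BackY:
  assumes "hlt B (if z > 0 then RdY else Rewind (Sim (tm_start M)))
      (regs (stack b (rev (map symbol_code ys)) q) z) v"
    and "stack b (rev (map symbol_code ys)) q \<le> B" "set ys \<subseteq> range Digit"
  shows "hlt B BackY (regs q (stack b (map symbol_code ys) (b * z + 4))) v"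
  using assms
proof (induction ys arbitrary: q)
  case Nil
  then show ?case using b5 by (simp add: halts_Goto_iff[of _ _ BackY] split: if_splits)
next
  case (Cons a ys)
  have s: "stack b (rev (map symbol_code (a # ys))) q = stack b (rev (map symbol_code ys)) (b * q + symbol_code a)"
    by (simp add: stack_append)
  have "b * q + symbol_code a \<le> stack b (rev (map symbol_code ys)) (b * q + symbol_code a)"
    using b5 by (intro stack_ge) auto
  also have "\<dots> \<le> B" using Cons.prems(2) unfolding s .
  finally have le: "b * q + symbol_code a \<le> B" .
  have "hlt B BackY (regs (b * q + symbol_code a) (stack b (map symbol_code ys) (b * z + 4))) v"
    using Cons.prems unfolding s by (intro Cons.IH) auto
  then show ?case using Cons.prems(3) le digit_less[of a] by (simp add: halts_Goto_iff[of _ _ BackY])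
qed

lemma stack_code_less:
  "set xs \<subseteq> range Digit \<Longrightarrow> stack b (rev (map symbol_code xs)) y < b ^ length xs * Suc y"
  using stack_less[of "rev (map symbol_code xs)" b y] digit_less(1) by (auto simp: subset_iff image_iff)

text \<open>One round per bit of \<open>y\<close>: the bits \<open>S\<close> placed so far are
  lifted off, the new bit goes directly onto the separator, and \<open>S\<close> is put back. Again
  \<open>binary z @ S\<close> is invariant, so one bound in terms of its length serves all
  rounds.\<close>

lemma hlt_RdY:
  assumes "hlt B (Rewind (Sim (tm_start M))) (regs (stack b (rev (map symbol_code (binary z @ S))) (b * X + 3)) 0) v"
    and "set S \<subseteq> range Digit" "b ^ (length (binary z @ S) + 1) * Suc X \<le> B"
  shows "hlt B RdY (regs (stack b (rev (map symbol_code S)) (b * X + 3)) z) v"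
  using assms
proof (induction z arbitrary: S rule: less_induct)
  case (less z)
  let ?n = "length (binary z @ S) + 1" and ?z = "z div 2" and ?S = "Digit (odd z) # S"
  let ?q = "b * (b * X + 3) + Suc (z mod 2)"
  have b: "0 < b" "1 \<le> b" using b5 by auto
  have len: "length S + 2 \<le> ?n" "0 < length (binary z)" by (auto simp: Suc_le_eq)
  have q: "?q = stack b [symbol_code (Digit (odd z))] (b * X + 3)"
    by (simp only: stack.simps code_odd)
  \<comment> \<open>The unread part of \<open>y\<close> is compact in base 2, so it takes no more
    room than its bits will take as base \<open>b\<close> digits.\<close>
  have Suc_z: "Suc ?z \<le> b ^ length (binary z)"
  proof -
    have "Suc ?z \<le> Suc z" by simp
    also have "\<dots> \<le> 2 ^ length (binary z)" using less_power_length_binary by (rule Suc_leI)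
    also have "\<dots> \<le> b ^ length (binary z)" using b5 by (intro power_mono) auto
    finally show ?thesis .
  qed
  have X: "Suc (b * X + 3) \<le> b * Suc X" and z: "Suc (b * ?z + 4) \<le> b * Suc ?z" using b5 by auto
  have "b ^ ?n * 1 \<le> b ^ ?n * Suc X" by (intro mult_le_mono) auto
  then have nB: "b ^ ?n \<le> B" using less.prems(3) by simp
  \<comment> \<open>Register 1 at its fullest in this round: all of \<open>S\<close> lies above the
    marker and the unread part of \<open>y\<close>.\<close>
  have B4: "stack b (rev (map symbol_code (rev S))) (b * ?z + 4) \<le> B"
  proof -
    have "stack b (rev (map symbol_code (rev S))) (b * ?z + 4) \<le> b ^ length S * Suc (b * ?z + 4)"
      using stack_code_less[of "rev S" "b * ?z + 4"] less.prems(2) by simp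
    also have "\<dots> \<le> b ^ length S * (b * b ^ length (binary z))"
      using le_trans[OF z mult_le_mono2[OF Suc_z]] by (intro mult_le_mono2)
    also have "\<dots> = b ^ ?n" by (simp add: power_add)
    finally show ?thesis using nB by simp
  qed
  have B4': "b * ?z + 4 \<le> B"
    using B4 stack_ge[OF b(1), of "b * ?z + 4"] le_trans by blast
  have Bq: "stack b (rev (map symbol_code S)) ?q \<le> B"
  proof -
    have "set ?S \<subseteq> range Digit" using less.prems(2) by auto
    then have "stack b (rev (map symbol_code ?S)) (b * X + 3) \<le> b ^ length ?S * Suc (b * X + 3)"
      using stack_code_less less_imp_le by blast
    also have "\<dots> \<le> b ^ length ?S * (b * Suc X)" using X by (intro mult_le_mono2)
    also have "\<dots> = b ^ (length S + 2) * Suc X" by (simp add: algebra_simps)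
    also have "\<dots> \<le> b ^ ?n * Suc X" by (intro mult_le_mono1 power_increasing len b)
    finally show ?thesis using less.prems(3) unfolding q by (simp add: stack_append)
  qed
  have Bq': "?q \<le> B" using Bq stack_ge[OF b(1), of ?q] le_trans by blast
  have S: "stack b (rev (map symbol_code S)) ?q = stack b (rev (map symbol_code ?S)) (b * X + 3)"
    unfolding q by (simp add: stack_append)
  have "hlt B (if ?z > 0 then RdY else Rewind (Sim (tm_start M)))
      (regs (stack b (rev (map symbol_code ?S)) (b * X + 3)) ?z) v"
  proof (cases "z < 2")
    case True
    with less.prems(1) show ?thesis by (simp add: binary_less_2)
  next
    case False
    have bin: "binary z @ S = binary ?z @ ?S" using False by (simp add: binary_ge_2)
    have "hlt B RdY (regs (stack b (rev (map symbol_code ?S)) (b * X + 3)) ?z) v"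
      by (rule less.IH) (use False less.prems in \<open>auto simp only: bin[symmetric]\<close>, auto)
    with False show ?thesis by simp
  qed
  then have "hlt B BackY (regs ?q (stack b (map symbol_code S) (b * ?z + 4))) v"
    using Bq less.prems(2) unfolding S[symmetric] by (intro hlt_BackY)
  then have "hlt B (InsY (z mod 2)) (regs (stack b (map symbol_code (rev S)) (b * X + 3)) (b * ?z + 4)) v"
    using B4 Bq' less.prems(2) by (intro hlt_InsY) (simp_all add: rev_map)
  then show ?case using B4' by (simp add: halts_Goto_iff[of _ _ RdY] rev_map)
qed

end

context tm_sim begin

lemma hlt_Start:
  assumes "hlt B (Rewind (Sim (tm_start M))) (regs (stack b (rev (map symbol_code (tm_input x y))) 0) 0) v"
    and B: "b ^ length (tm_input x y) \<le> B"
  shows "hlt B Start (regs x y) v"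
proof -
  let ?lx = "length (binary x)" and ?ly = "length (binary y)"
  let ?X = "stack b (rev (map symbol_code (binary x))) 0"
  have b: "0 < b" "1 \<le> b" using b5 by auto
  have n: "length (tm_input x y) = ?lx + 1 + ?ly" by (simp add: tm_input_def)
  have X: "Suc ?X \<le> b ^ ?lx"
    using stack_code_less[OF set_binary, of x 0] by simp
  have "stack b (rev (map symbol_code (tm_input x y))) 0
      = stack b (rev (map symbol_code (binary y))) (b * ?X + 3)"
    by (simp add: tm_input_def stack_append)
  with assms(1) have "hlt B (Rewind (Sim (tm_start M)))
      (regs (stack b (rev (map symbol_code (binary y @ []))) (b * ?X + 3)) 0) v" by simp
  moreover have "b ^ (length (binary y @ []) + 1) * Suc ?X \<le> B"
  proof -
    have "b ^ (length (binary y @ []) + 1) * Suc ?X \<le> b ^ (?ly + 1) * b ^ ?lx"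
      using mult_le_mono2[OF X] by simp
    also have "\<dots> = b ^ length (tm_input x y)" unfolding n by (simp add: power_add mult_ac)
    finally show ?thesis using B by simp
  qed
  ultimately have RdY: "hlt B RdY (regs (stack b (rev (map symbol_code [])) (b * ?X + 3)) y) v"
    by (intro hlt_RdY) auto
  have "b * ?X + 3 \<le> b * Suc ?X" using b5 by simp
  also have "\<dots> \<le> b * b ^ ?lx" using X by (rule mult_le_mono2)
  also have "\<dots> = b ^ (?lx + 1)" by simp
  also have "\<dots> \<le> b ^ length (tm_input x y)" unfolding n using b by (intro power_increasing) auto
  finally have "b * ?X + 3 \<le> B" using B by simp
  with RdY have MvX: "hlt B MvX (regs 0 (stack b (map symbol_code (binary x @ [])) (b * y + 4))) v"
    using set_binary by (simp add: hlt_MvX)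
  have "set (map symbol_code (binary x)) \<subseteq> {..<b}"
    using set_binary[of x] digit_less(1) by auto
  then have "stack b (map symbol_code (binary x)) (b * y + 4) \<le> b ^ ?lx * Suc (b * y + 4)"
    using stack_less[of "map symbol_code (binary x)" b "b * y + 4"]
    by (simp add: image_subset_iff less_imp_le)
  also have "\<dots> \<le> b ^ ?lx * (b * b ^ ?ly)"
  proof -
    have "Suc y \<le> 2 ^ ?ly" using less_power_length_binary by (rule Suc_leI)
    also have "\<dots> \<le> b ^ ?ly" using b5 by (intro power_mono) auto
    finally have "b * Suc y \<le> b * b ^ ?ly" by (rule mult_le_mono2)
    then show ?thesis using b5 by (intro mult_le_mono2) simp
  qed
  also have "\<dots> = b ^ length (tm_input x y)" unfolding n by (simp add: power_add)
  finally have le: "stack b (map symbol_code (binary x @ [])) (b * y + 4) \<le> B" using B by simp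
  with stack_ge[OF b(1), of "b * y + 4" "map symbol_code (binary x)"] have "b * y + 4 \<le> B" by simp
  then show ?thesis
    using hlt_RdX[OF MvX le] by (rule_tac halts_goto) simp
qed

section \<open>The tape as two numbers\<close>

text \<open>Nonblank cells lie within distance \<open>N\<close> of 0, and the head may stand one
  cell beyond. From each such position a window of \<open>2 * N + 2\<close> cells reaches the far
  end of the nonblank part. The finite sum thus represents the whole half tape, and shifting the
  window loses nothing. The scanned cell belongs to the right half.\<close>

definition right_num :: "nat \<Rightarrow> (int \<Rightarrow> symbol) \<Rightarrow> int \<Rightarrow> nat" where
  "right_num N t h = (\<Sum>k<2 * N + 2. symbol_code (t (h + int k)) * b ^ k)"

definition left_num :: "nat \<Rightarrow> (int \<Rightarrow> symbol) \<Rightarrow> int \<Rightarrow> nat" where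
  "left_num N t h = (\<Sum>k<2 * N + 2. symbol_code (t (h - 1 - int k)) * b ^ k)"

definition supported :: "nat \<Rightarrow> (int \<Rightarrow> symbol) \<Rightarrow> bool" where
  "supported N t \<longleftrightarrow> (\<forall>i. int N < \<bar>i\<bar> \<longrightarrow> t i = Blank)"

lemma digit_sum_shift:
  assumes "f W = 0"
  shows "(\<Sum>k<W. f k * b ^ k) = b * (\<Sum>k<W. f (Suc k) * b ^ k) + f 0"
proof -
  have "(\<Sum>k<W. f k * b ^ k) = (\<Sum>k<Suc W. f k * b ^ k)" using assms by simp
  also have "\<dots> = f 0 + (\<Sum>k<W. f (Suc k) * b ^ Suc k)" by (subst sum.lessThan_Suc_shift) simp
  finally show ?thesis by (simp add: sum_distrib_left mult_ac)
qed

lemma digit_sum_less: "\<forall>k. f k < b \<Longrightarrow> (\<Sum>k<W. f k * b ^ k) < b ^ W"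
proof (induction W)
  case (Suc W)
  have "f W * b ^ W + b ^ W = Suc (f W) * b ^ W" by simp
  also have "\<dots> \<le> b * b ^ W" using Suc.prems by (intro mult_le_mono1) (simp add: Suc_le_eq)
  finally show ?case using Suc by simp
qed simp

lemma right_num_shift:
  assumes "supported N t" "- int N - 1 \<le> h"
  shows "right_num N t h = b * right_num N t (h + 1) + symbol_code (t h)"
proof -
  have "t (h + int (2 * N + 2)) = Blank" using assms by (auto simp: supported_def)
  then show ?thesis
    unfolding right_num_def by (subst digit_sum_shift) (auto simp: algebra_simps)
qed

lemma left_num_shift:
  assumes "supported N t" "h \<le> int N + 1"
  shows "left_num N t (h + 1) = b * left_num N t h + symbol_code (t h)"
proof -
  have "t (h + 1 - 1 - int (2 * N + 2)) = Blank" using assms by (auto simp: supported_def)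
  then show ?thesis
    unfolding left_num_def by (subst digit_sum_shift) (auto simp: algebra_simps)
qed

lemma right_num_upd: "i < h \<Longrightarrow> right_num N (t(i := s)) h = right_num N t h"
  and left_num_upd: "h \<le> i \<Longrightarrow> left_num N (t(i := s)) h = left_num N t h"
  unfolding right_num_def left_num_def by (auto intro!: sum.cong)

lemma right_num_less: "range t \<subseteq> tm_symbols M \<Longrightarrow> right_num N t h < b ^ (2 * N + 2)"
  and left_num_less: "range t \<subseteq> tm_symbols M \<Longrightarrow> left_num N t h < b ^ (2 * N + 2)"
  unfolding right_num_def left_num_def by (intro digit_sum_less; use code_less in auto)+

lemma right_num_eq_0: "right_num N t h = 0 \<longleftrightarrow> (\<forall>k<2 * N + 2. t (h + int k) = Blank)"
  and left_num_eq_0: "left_num N t h = 0 \<longleftrightarrow> (\<forall>k<2 * N + 2. t (h - 1 - int k) = Blank)"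
  using b5 unfolding right_num_def left_num_def
  by (subst sum_eq_0_iff; auto simp del: add_2_eq_Suc')+

section \<open>Simulated steps, rewinding and reading the output\<close>

text \<open>Every number that is pushed on the way is the left or right number of the new tape at
  \<open>h - 1\<close>, \<open>h\<close> or \<open>h + 1\<close>, so the size of a window bounds
  it.\<close>

lemma hlt_Sim_step:
  assumes q: "q \<noteq> tm_halt M" "tm_delta M q (t h) = (q', s, d)"
    and t: "range t \<subseteq> tm_symbols M" "supported N t" and s: "s \<in> tm_symbols M" and h: "\<bar>h\<bar> \<le> int N"
    and B: "b ^ (2 * N + 2) \<le> B"
    and cont: "hlt B (Sim q') (regs (left_num N (t(h := s)) (move_head d h)) (right_num N (t(h := s)) (move_head d h))) v"
  shows "hlt B (Sim q) (regs (left_num N t h) (right_num N t h)) v"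
proof -
  let ?t = "t(h := s)"
  have t': "range ?t \<subseteq> tm_symbols M" "supported N ?t"
    using t s h by (auto simp: supported_def)
  have le: "left_num N ?t i \<le> B" "right_num N ?t i \<le> B" for i
    using left_num_less[OF t'(1)] right_num_less[OF t'(1)] B by (meson le_trans less_imp_le)+
  have th: "t h \<in> tm_symbols M" "symbol_code (t h) < b" "t (h - 1) \<in> tm_symbols M" "symbol_code (t (h - 1)) < b"
    using t(1) code_less by auto
  have R: "right_num N t h = b * right_num N ?t (h + 1) + symbol_code (t h)"
    using right_num_shift[OF t(2), of h] h by (simp add: right_num_upd)
  have R': "right_num N ?t h = b * right_num N ?t (h + 1) + symbol_code s"
    using right_num_shift[OF t'(2), of h] h by simp
  have L: "left_num N ?t h = left_num N t h" by (simp add: left_num_upd)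
  show ?thesis
  proof (cases d)
    case MRight
    have "left_num N ?t (h + 1) = b * left_num N t h + symbol_code s"
      using left_num_shift[OF t'(2), of h] h L by simp
    with MRight cont le(1)[of "h + 1"] show ?thesis
      using q th by (rule_tac halts_goto) (simp add: R)
  next
    case MStay
    with cont le(2)[of h] show ?thesis
      using q th by (rule_tac halts_goto) (simp add: R R' L)
  next
    case MLeft
    have "left_num N t h = b * left_num N ?t (h - 1) + symbol_code (t (h - 1))"
      using left_num_shift[OF t'(2), of "h - 1"] h L by simp
    moreover have "right_num N ?t (h - 1) = b * right_num N ?t h + symbol_code (t (h - 1))"
      using right_num_shift[OF t'(2), of "h - 1"] h by simp
    ultimately show ?thesis using MLeft cont le(2)[of "h - 1"] le(2)[of h]
      using q th by (rule_tac halts_goto) (simp add: R R')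
  qed
qed

text \<open>The program does not know the head position; it only sees that the left stack has become
  0. The stopping place is therefore characterised by the tape alone, as the first position with
  only blanks to its left, and each caller has to identify it.\<close>

lemma hlt_Rewind:
  assumes t: "range t \<subseteq> tm_symbols M" "supported N t" and B: "b ^ (2 * N + 2) \<le> B"
    and "\<And>h'. h' \<le> h \<Longrightarrow> - int N - 1 \<le> h' \<Longrightarrow> left_num N t h' = 0 \<Longrightarrow>
        (\<And>i. h' < i \<Longrightarrow> i \<le> h \<Longrightarrow> left_num N t i \<noteq> 0) \<Longrightarrow> hlt B s (regs 0 (right_num N t h')) v"
    and "- int N - 1 \<le> h" "h \<le> int N + 1"
  shows "hlt B (Rewind s) (regs (left_num N t h) (right_num N t h)) v"
  using assms(4-)
proof (induction "nat (h + int N + 1)" arbitrary: h rule: less_induct)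
  case less
  show ?case
  proof (cases "left_num N t h = 0")
    case True
    then have "hlt B s (regs 0 (right_num N t h)) v"
      using less.prems(2) by (intro less.prems(1)) auto
    with True show ?thesis by (rule_tac halts_goto) simp
  next
    case False
    then obtain k where "t (h - 1 - int k) \<noteq> Blank" by (auto simp: left_num_eq_0)
    then have "\<bar>h - 1 - int k\<bar> \<le> int N" using t(2) by (meson supported_def not_le)
    then have h: "- int N \<le> h" by linarith
    have "hlt B (Rewind s) (regs (left_num N t (h - 1)) (right_num N t (h - 1))) v"
    proof (rule less.hyps)
      fix h' assume h': "h' \<le> h - 1" "- int N - 1 \<le> h'" "left_num N t h' = 0"
        "\<And>i. h' < i \<Longrightarrow> i \<le> h - 1 \<Longrightarrow> left_num N t i \<noteq> 0"
      have "left_num N t i \<noteq> 0" if "h' < i" "i \<le> h" for i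
        using h'(4)[of i] False that by (cases "i = h") auto
      with h' show "hlt B s (regs 0 (right_num N t h')) v" by (intro less.prems(1)) auto
    qed (use h less.prems in auto)
    moreover have "left_num N t h = b * left_num N t (h - 1) + symbol_code (t (h - 1))"
      using left_num_shift[OF t(2), of "h - 1"] less.prems by simp
    moreover have "right_num N t (h - 1) = b * right_num N t h + symbol_code (t (h - 1))"
      using right_num_shift[OF t(2), of "h - 1"] h by simp
    moreover have "right_num N t (h - 1) \<le> B" using right_num_less[OF t(1)] B by (meson le_trans less_imp_le)
    moreover have "symbol_code (t (h - 1)) < b" using t(1) code_less by auto
    ultimately show ?thesis using False by (rule_tac halts_goto) auto
  qed
qed

text \<open>Register 0 holds the value of the digits of \<open>u\<close> left of the head. As long
  as the head is left of \<open>s\<close>, \<open>nat\<close> truncates to 0 and this prefix is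
  empty, which also covers the start with register 0 empty.\<close>

lemma hlt_Output:
  assumes t: "t = tape_of s u" "supported N t" and u: "set u \<subseteq> range Digit" and u0: "u \<noteq> []" and B: "2 ^ length u \<le> B"
    and "- int N - 1 \<le> h" "h \<le> s + int (length u)"
  shows "hlt B Output (regs (digits_val 0 (take (nat (h - s)) u)) (right_num N t h)) (digits_val 0 u)"
  using assms(5-)
proof (induction "nat (s + int (length u) - h)" arbitrary: h rule: less_induct)
  case less
  show ?case
  proof (cases "h = s + int (length u)")
    case True
    then have "right_num N t h = 0" by (simp add: right_num_eq_0 t(1) tape_of_def)
    with True show ?thesis by (rule_tac halts_goto) simp
  next
    case False
    with less.prems have lt: "h < s + int (length u)" by simp
    let ?v = "\<lambda>h. digits_val 0 (take (nat (h - s)) u)"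
    have IH: "hlt B Output (regs (?v (h + 1)) (right_num N t (h + 1))) (digits_val 0 u)"
      using less.prems lt by (intro less.hyps) auto
    have R: "right_num N t h = b * right_num N t (h + 1) + symbol_code (t h)"
      using right_num_shift[OF t(2), of h] less.prems by simp
    \<comment> \<open>The last digit of \<open>u\<close> is still ahead and is not blank, so the
      loop test succeeds.\<close>
    have nz: "right_num N t h \<noteq> 0"
    proof -
      define k where "k = nat (s + int (length u) - 1 - h)"
      have hk: "h + int k = s + int (length u) - 1" using lt by (simp add: k_def)
      have "u ! (length u - 1) \<in> range Digit" using u u0 by (auto intro: nth_mem)
      moreover have "t (h + int k) = u ! (length u - 1)"
        using u0 unfolding hk t(1) tape_of_def by (auto intro!: arg_cong[of _ _ "nth u"])
      ultimately have b: "t (h + int k) \<noteq> Blank" by auto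
      then have "\<bar>h + int k\<bar> \<le> int N" using t(2) by (meson supported_def not_le)
      then have "k < 2 * N + 2" using less.prems by linarith
      with b show ?thesis by (auto simp: right_num_eq_0)
    qed
    show ?thesis
    proof (cases "h < s")
      case True
      then have "t h = Blank" "?v (h + 1) = ?v h" by (simp_all add: t(1) tape_of_def)
      with IH R nz b5 show ?thesis by (rule_tac halts_goto) simp
    next
      case False
      define j where "j = nat (h - s)"
      have j: "j < length u" "nat (h + 1 - s) = Suc j" using lt False by (auto simp: j_def)
      then obtain d where d: "u ! j = Digit d" using u by (metis nth_mem rangeE subsetD)
      have th: "t h = Digit d" using lt False d by (simp add: t(1) tape_of_def j_def)
      have v: "?v (h + 1) = 2 * ?v h + of_bool d"
        unfolding j(2) j_def[symmetric] by (simp add: take_Suc_conv_app_nth[OF j(1)] digits_val_append d)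
      have "?v (h + 1) \<le> 2 ^ length (take (Suc j) u) * Suc 0"
        unfolding j(2) by (rule less_imp_le[OF digits_val_less])
      also have "\<dots> \<le> 2 ^ length u" by simp
      finally have "?v (h + 1) \<le> B" using B by simp
      with IH R nz b5 show ?thesis unfolding v
        by (rule_tac halts_goto) (auto simp: th)
    qed
  qed
qed

lemma hlt_run:
  assumes run: "(tm_step M)\<^sup>*\<^sup>* c (tm_halt M, tape_of s u, h0)" "(tm_step M)\<^sup>*\<^sup>* (tm_init M w) c"
    and c: "c = (q, t, h)"
    and heads: "\<And>q t h. (tm_step M)\<^sup>*\<^sup>* (tm_init M w) (q, t, h) \<Longrightarrow>
        \<bar>h\<bar> \<le> int N \<and> range t \<subseteq> tm_symbols M \<and> supported N t \<and> q \<in> tm_states M"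
    and u: "set u \<subseteq> range Digit" "u \<noteq> []" and B: "b ^ (2 * N + 2) \<le> B"
  shows "hlt B (Sim q) (regs (left_num N t h) (right_num N t h)) (digits_val 0 u)"
  using run c
proof (induction arbitrary: q t h rule: converse_rtranclp_induct)
  case base
  let ?t = "tape_of s u"
  have q: "q = tm_halt M" "t = ?t" using base by auto
  have inv: "\<bar>h\<bar> \<le> int N" "range ?t \<subseteq> tm_symbols M" "supported N ?t"
    using heads[of q t h] base by auto
  have "?t s = u ! 0" "?t (s + int (length u) - 1) = u ! (length u - 1)"
    using u(2) by (auto simp: tape_of_def intro!: arg_cong[of _ _ "nth u"])
  moreover have "u ! 0 \<in> range Digit" "u ! (length u - 1) \<in> range Digit"
    using u by (auto intro: nth_mem)
  ultimately have nb: "?t s \<noteq> Blank" "?t (s + int (length u) - 1) \<noteq> Blank" by auto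
  \<comment> \<open>Both ends of the output are nonblank, hence within distance \<open>N\<close> of
    0; this limits the length of \<open>u\<close> and so the value accumulated in register
    0.\<close>
  then have sN: "\<bar>s\<bar> \<le> int N" "\<bar>s + int (length u) - 1\<bar> \<le> int N"
    using inv(3) by (meson supported_def not_le)+
  have "2 ^ length u \<le> (2::nat) ^ (2 * N + 2)" using sN by (intro power_increasing) auto
  also have "\<dots> \<le> b ^ (2 * N + 2)" using b5 by (intro power_mono) auto
  finally have B': "2 ^ length u \<le> B" using B by simp
  have "hlt B (Rewind Output) (regs (left_num N ?t h) (right_num N ?t h)) (digits_val 0 u)"
  proof (rule hlt_Rewind[OF inv(2,3) B])
    fix h' assume h': "h' \<le> h" "- int N - 1 \<le> h'" "left_num N ?t h' = 0"
    have "h' \<le> s"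
    proof (rule ccontr)
      assume "\<not> h' \<le> s"
      then have "h' - 1 - int (nat (h' - 1 - s)) = s" "nat (h' - 1 - s) < 2 * N + 2"
        using sN(1) inv(1) h' by auto
      with h'(3) nb(1) show False by (metis left_num_eq_0)
    qed
    then show "hlt B Output (regs 0 (right_num N ?t h')) (digits_val 0 u)"
      using hlt_Output[OF refl inv(3) u B' h'(2)] by simp
  qed (use inv in auto)
  then show ?case unfolding q by (rule_tac halts_goto) simp
next
  case (step c c1)
  from step.hyps(1) step.prems(2) obtain q' s d where
    st: "q \<noteq> tm_halt M" "tm_delta M q (t h) = (q', s, d)" "c1 = (q', t(h := s), move_head d h)"
    by (auto elim!: tm_step.cases)
  have c1: "(tm_step M)\<^sup>*\<^sup>* (tm_init M w) c1" using step by auto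
  have i: "\<bar>h\<bar> \<le> int N" "range t \<subseteq> tm_symbols M" "supported N t" "q \<in> tm_states M"
    using heads[of q t h] step.prems by auto
  have s: "s \<in> tm_symbols M" using delta_in(2)[OF i(4) _ st(2)] i(2) by auto
  show ?case
    by (rule hlt_Sim_step[OF st(1,2) i(2,3) s i(1) B]) (rule step.IH[OF c1 st(3)])
qed

text \<open>Loading leaves the stacks as for a head just behind the input, whereas \<open>M\<close>
  starts at 0. Rewinding stops exactly there: the first input symbol is nonblank, so the left half
  is nonzero at every position from 1 up to the end of the input and zero at 0.\<close>

lemma hlt_machine:
  assumes run: "tm_outputs M (tm_input x y) u"
    and heads: "\<And>q t h. (tm_step M)\<^sup>*\<^sup>* (tm_init M (tm_input x y)) (q, t, h) \<Longrightarrow>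
        \<bar>h\<bar> \<le> int N \<and> range t \<subseteq> tm_symbols M \<and> supported N t \<and> q \<in> tm_states M"
    and u: "set u \<subseteq> range Digit" "u \<noteq> []" and N: "length (tm_input x y) \<le> N" and B: "b ^ (2 * N + 2) \<le> B"
  shows "hlt B Start (regs x y) (digits_val 0 u)"
proof -
  let ?w = "tm_input x y"
  let ?t = "tape_of 0 ?w" and ?n = "length ?w"
  have init: "(tm_step M)\<^sup>*\<^sup>* (tm_init M ?w) (tm_start M, ?t, 0)" by (simp add: tm_init_def)
  have inv: "range ?t \<subseteq> tm_symbols M" "supported N ?t" using heads[OF init] by auto
  have L: "left_num N ?t (int k) = stack b (rev (map symbol_code (take k ?w))) 0" if "k \<le> ?n" for k
    using that
  proof (induction k)
    case 0
    have "left_num N ?t 0 = 0" by (simp add: left_num_eq_0 tape_of_def)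
    then show ?case by simp
  next
    case (Suc k)
    have "left_num N ?t (int k + 1) = b * left_num N ?t (int k) + symbol_code (?t (int k))"
      using Suc.prems N by (intro left_num_shift[OF inv(2)]) auto
    moreover have "?t (int k) = ?w ! k" using Suc.prems by (simp add: tape_of_def)
    ultimately show ?case using Suc by (simp add: take_Suc_conv_app_nth add.commute)
  qed
  have R: "right_num N ?t (int ?n) = 0" by (simp add: right_num_eq_0 tape_of_def)
  have "?w \<noteq> []" by (simp add: tm_input_def)
  have w0: "?t 0 \<noteq> Blank"
  proof -
    have "binary x ! 0 \<in> range Digit" using set_binary[of x] by (meson nth_mem length_greater_0_conv binary_neq_Nil subsetD)
    then show ?thesis by (auto simp: tape_of_def tm_input_def nth_append)
  qed
  obtain s h0 where run': "(tm_step M)\<^sup>*\<^sup>* (tm_init M ?w) (tm_halt M, tape_of s u, h0)"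
    using run by (auto simp: tm_outputs_def)
  have Sim: "hlt B (Sim (tm_start M)) (regs (left_num N ?t 0) (right_num N ?t 0)) (digits_val 0 u)"
    by (rule hlt_run[OF run' rtranclp.rtrancl_refl _ heads u B]) (simp add: tm_init_def)
  have L0: "left_num N ?t 0 = 0" using L[of 0] by simp
  have "hlt B (Rewind (Sim (tm_start M))) (regs (left_num N ?t (int ?n)) (right_num N ?t (int ?n))) (digits_val 0 u)"
  proof (rule hlt_Rewind[OF inv B])
    fix h' assume h': "h' \<le> int ?n" "- int N - 1 \<le> h'" "left_num N ?t h' = 0"
      "\<And>i. h' < i \<Longrightarrow> i \<le> int ?n \<Longrightarrow> left_num N ?t i \<noteq> 0"
    have "\<not> h' < 0" using h'(4)[of 0] L0 by auto
    moreover have "\<not> 0 < h'"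
    proof
      assume "0 < h'"
      then have "h' - 1 - int (nat (h' - 1)) = 0" "nat (h' - 1) < 2 * N + 2"
        using h' N by auto
      with h'(3) w0 show False by (metis left_num_eq_0)
    qed
    ultimately have "h' = 0" by simp
    with Sim L0 show "hlt B (Sim (tm_start M)) (regs 0 (right_num N ?t h')) (digits_val 0 u)" by simp
  qed (use N in auto)
  then have "hlt B (Rewind (Sim (tm_start M))) (regs (stack b (rev (map symbol_code ?w)) 0) 0) (digits_val 0 u)"
    unfolding R L[OF order_refl] by simp
  moreover have "b ^ ?n \<le> B"
    using B N b5 power_increasing[of ?n "2 * N + 2" b] by simp
  ultimately show ?thesis by (rule hlt_Start)
qed

end

section \<open>From the number of cells to the head position\<close>

text \<open>A move changes the position by at most 1, so the head has visited every cell between 0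
  and its present place. The number of cells thus bounds the distance from 0.\<close>

lemma reachable_cells:
  "(tm_step M)\<^sup>*\<^sup>* (tm_init M w) c \<Longrightarrow> {min 0 (snd (snd c))..max 0 (snd (snd c))} \<subseteq> tm_cells M w"
proof (induction rule: rtranclp_induct)
  case base
  have "(tm_step M)\<^sup>*\<^sup>* (tm_init M w) (tm_start M, tape_of 0 w, 0)" by (simp add: tm_init_def)
  then show ?case by (auto simp: tm_init_def tm_cells_def)
next
  case (step c c')
  obtain q t h q' t' h' where c: "c = (q, t, h)" "c' = (q', t', h')" by (metis prod_cases3)
  have "\<bar>move_head d h - h\<bar> \<le> 1" for d by (cases d) auto
  with step.hyps(2) have "\<bar>h' - h\<bar> \<le> 1" unfolding c by cases auto
  then have "{min 0 h'..max 0 h'} \<subseteq> insert h' {min 0 h..max 0 h}" by auto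
  moreover have "h' \<in> tm_cells M w"
    using step.hyps c unfolding tm_cells_def by (blast intro: rtranclp.rtrancl_into_rtrancl)
  ultimately show ?case using step.IH c by auto
qed

lemma reachable_head_bound:
  assumes "finite (tm_cells M w)" "card (tm_cells M w) \<le> n" "(tm_step M)\<^sup>*\<^sup>* (tm_init M w) (q, t, h)"
  shows "\<bar>h\<bar> < int n"
proof -
  have "card {min 0 h..max 0 h} \<le> n"
    using card_mono[OF assms(1) reachable_cells[OF assms(3)]] assms(2) by simp
  then show ?thesis by (auto split: if_splits simp: min_def max_def)
qed

lemma set_tm_input: "set (tm_input x y) \<subseteq> {Digit False, Digit True, Sep}"
proof -
  have "d = Digit False \<or> d = Digit True" if "d \<in> set (binary n)" for d n
    using set_binary[of n] that by (metis (full_types) rangeE subsetD)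
  then show ?thesis by (auto simp: tm_input_def)
qed

lemma reachable_inv:
  assumes tm: "turing_machine M" and w: "w = tm_input x y" "length w \<le> N"
    and run: "(tm_step M)\<^sup>*\<^sup>* (tm_init M w) c"
    and heads: "\<And>q t h. (tm_step M)\<^sup>*\<^sup>* (tm_init M w) (q, t, h) \<Longrightarrow> \<bar>h\<bar> \<le> int N"
  shows "range (fst (snd c)) \<subseteq> tm_symbols M \<and> (\<forall>i. int N < \<bar>i\<bar> \<longrightarrow> fst (snd c) i = Blank) \<and> fst c \<in> tm_states M"
  using run
proof (induction rule: rtranclp_induct)
  case base
  have "tape_of 0 w i \<in> tm_symbols M" for i
  proof (cases "0 \<le> i \<and> i < int (length w)")
    case True
    then have "w ! nat i \<in> set w" by (intro nth_mem) auto
    then show ?thesis using True set_tm_input[of x y] tm w by (auto simp: tape_of_def turing_machine_def)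
  qed (use tm in \<open>auto simp: tape_of_def turing_machine_def\<close>)
  then show ?case using w tm by (auto simp: tm_init_def turing_machine_def) (auto simp: tape_of_def)
next
  case (step c c')
  from step.hyps(2) obtain q t h q' s d where
    st: "c = (q, t, h)" "tm_delta M q (t h) = (q', s, d)" "c' = (q', t(h := s), move_head d h)"
    by cases auto
  have h: "\<bar>h\<bar> \<le> int N" using heads step.hyps(1) st(1) by auto
  have "t h \<in> tm_symbols M" "q \<in> tm_states M" using step.IH st(1) by auto
  then have "q' \<in> tm_states M" "s \<in> tm_symbols M"
    using tm st(2) unfolding turing_machine_def by fastforce+
  then show ?case using step.IH st h by auto
qed

text \<open>This converts linear length into polynomial size. The factor 8 consists of a 2 for each
  numeral and a 2 for the separator.\<close>

lemma power2_input_le: "(2::nat) ^ length (tm_input x y) \<le> 8 * (Suc x * Suc y)"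
proof -
  have "(2::nat) ^ length (tm_input x y) = 2 ^ length (binary x) * 2 * 2 ^ length (binary y)"
    by (simp add: tm_input_def power_add mult_ac)
  also have "\<dots> \<le> (2 * Suc x) * 2 * (2 * Suc y)"
    using length_binary_le[of x] length_binary_le[of y] by (intro mult_le_mono) auto
  finally show ?thesis by (simp add: algebra_simps)
qed

lemma linear_space_imp_three_counter:
  assumes "linear_space_computable f"
  shows "three_counter_polytime f"
proof -
  obtain M c where tm: "turing_machine M"
    and out: "\<And>x y. tm_outputs M (tm_input x y) (binary (f (x, y)))"
    and fin: "\<And>x y. finite (tm_cells M (tm_input x y))"
    and card: "\<And>x y. card (tm_cells M (tm_input x y)) \<le> c * length (tm_input x y)"
    using assms unfolding linear_space_computable_def by blast
  define b where "b = Max (symbol_code ` tm_symbols M) + 5"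
  interpret tm_sim M b
  proof
    show "turing_machine M" by (rule tm)
    show "symbol_code s < b" if "s \<in> tm_symbols M" for s
    proof -
      have "symbol_code s \<le> Max (symbol_code ` tm_symbols M)"
        using that tm by (intro Max_ge) (auto simp: turing_machine_def)
      then show ?thesis by (simp add: b_def)
    qed
  qed (simp add: b_def)
  have "Start \<in> ctls" by (simp add: ctls_def)
  then obtain P where P: "counter_program 3 P" and Prun: "\<And>B r v. hlt B Start r v \<Longrightarrow> r 2 = 0 \<Longrightarrow> (\<forall>k. r k \<le> B) \<Longrightarrow>
    (\<exists>n pc w. n \<le> (length P * Suc B ^ 3)\<^sup>2 \<and> (cm_step P ^^ n) (0, [r 0, r 1, 0]) (pc, w) \<and>
      cm_halted P (pc, w) \<and> w ! 0 = v)"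
    using prog_compile[of ctls "sim_body M b" Start, OF finite_ctls sim_body_ok] by auto
  \<comment> \<open>The 6 stems from the squared cube in the step count, \<open>2 * c + 3\<close>
    from \<open>Suc B \<le> b ^ (2 * N + 3)\<close> with \<open>N = c * ?n\<close> and
    \<open>1 \<le> ?n\<close>, and the factor \<open>b\<close> from \<open>b \<le> 2 ^ b\<close>
    when passing to base 2.\<close>
  define e where "e = 6 * (2 * c + 3) * b"
  \<comment> \<open>The inner polynomial is (1 + x) + (1 + x) y, that is (1 + x)(1 + y). The leading
    1 pays for the final \<open>Halt\<close>.\<close>
  define p :: "real poly poly" where
    "p = 1 + of_nat ((length P)\<^sup>2) * (8 * [:[:1, 1:], [:1, 1:]:]) ^ e"
  have p: "poly (poly p [:real y:]) (real x) = 1 + real ((length P)\<^sup>2) * (8 * (real (Suc x) * real (Suc y))) ^ e" for x y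
    by (simp add: p_def of_nat_poly algebra_simps)
  have "\<exists>t pc v. cm_halts_in P (0, [x, y, 0]) t (pc, v) \<and> v ! 0 = f (x, y) \<and>
        real t \<le> poly (poly p [:real y:]) (real x)" for x y
  proof -
    let ?w = "tm_input x y"
    let ?n = "length ?w"
    define N where "N = c * ?n"
    have heads: "\<bar>h\<bar> \<le> int N" if "(tm_step M)\<^sup>*\<^sup>* (tm_init M ?w) (q, t, h)" for q t h
      using reachable_head_bound[OF fin card that] by (simp add: N_def)
    \<comment> \<open>The input cells count as used cells, so \<open>c * ?n\<close> is at least
      \<open>?n\<close>.\<close>
    have "?n = card {0..<int ?n}" by simp
    also have "\<dots> \<le> card (tm_cells M ?w)" by (intro card_mono fin) (auto simp: tm_cells_def)
    also have "\<dots> \<le> N" using card by (simp add: N_def)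
    finally have nN: "?n \<le> N" .
    have inv: "\<bar>h\<bar> \<le> int N \<and> range t \<subseteq> tm_symbols M \<and> supported N t \<and> q \<in> tm_states M"
      if "(tm_step M)\<^sup>*\<^sup>* (tm_init M ?w) (q, t, h)" for q t h
      using heads[OF that] reachable_inv[OF tm refl nN that heads] by (simp add: supported_def)
    define B where "B = b ^ (2 * N + 2)"
    have h: "hlt B Start (regs x y) (f (x, y))"
      using hlt_machine[OF out inv set_binary binary_neq_Nil nN, of B] by (simp add: digits_val_binary B_def)
    have le: "z \<le> B" if "length (binary z) \<le> ?n" for z
    proof -
      have "z \<le> 2 ^ length (binary z)" using less_power_length_binary less_imp_le by blast
      also have "\<dots> \<le> b ^ length (binary z)" using b5 by (intro power_mono) auto
      also have "\<dots> \<le> B" unfolding B_def using b5 that nN by (intro power_increasing) auto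
      finally show ?thesis .
    qed
    have "x \<le> B" "y \<le> B" by (rule le, simp add: tm_input_def)+
    then have "\<forall>k. regs x y k \<le> B" by (simp add: regs_def)
    from Prun[OF h _ this] obtain n pc v where n: "n \<le> (length P * Suc B ^ 3)\<^sup>2"
      "(cm_step P ^^ n) (0, [x, y, 0]) (pc, v)" "cm_halted P (pc, v)" "v ! 0 = f (x, y)"
      by auto
    have n1: "1 \<le> ?n" by (simp add: tm_input_def)
    have "0 < B" using b5 by (simp add: B_def)
    then have "Suc B \<le> 2 * B" by simp
    also have "\<dots> \<le> b * B" using b5 by (intro mult_le_mono1) simp
    also have "\<dots> = b ^ (2 * N + 3)" by (simp add: B_def eval_nat_numeral)
    also have "\<dots> \<le> b ^ ((2 * c + 3) * ?n)"
      using b5 n1 by (intro power_increasing) (auto simp: N_def algebra_simps)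
    finally have "(Suc B ^ 3)\<^sup>2 \<le> ((b ^ ((2 * c + 3) * ?n)) ^ 3)\<^sup>2" by (intro power_mono) auto
    also have "\<dots> = b ^ (6 * (2 * c + 3) * ?n)" by (simp flip: power_mult add: mult_ac)
    also have "\<dots> \<le> (2 ^ b) ^ (6 * (2 * c + 3) * ?n)" by (intro power_mono less_imp_le[OF less_exp]) simp
    also have "\<dots> = (2 ^ ?n) ^ e" unfolding e_def by (simp flip: power_mult add: mult_ac)
    also have "\<dots> \<le> (8 * (Suc x * Suc y)) ^ e" using power2_input_le by (intro power_mono) auto
    finally have "(length P)\<^sup>2 * (Suc B ^ 3)\<^sup>2 \<le> (length P)\<^sup>2 * (8 * (Suc x * Suc y)) ^ e" by (rule mult_le_mono2)
    then have "Suc n \<le> 1 + (length P)\<^sup>2 * (8 * (Suc x * Suc y)) ^ e"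
      using n(1) by (simp only: power_mult_distrib)
    then have "real (Suc n) \<le> real (1 + (length P)\<^sup>2 * (8 * (Suc x * Suc y)) ^ e)" by (rule of_nat_mono)
    also have "\<dots> = poly (poly p [:real y:]) (real x)" unfolding p
      by (simp only: of_nat_add of_nat_mult of_nat_power of_nat_1 of_nat_numeral)
    finally show ?thesis
      using n by (intro exI[of _ "Suc n"] exI[of _ pc] exI[of _ v]) (auto simp: cm_halts_in_def)
  qed
  then show ?thesis
    unfolding three_counter_polytime_def using P by (intro exI[of _ P] exI[of _ 0] exI[of _ p]) auto
qed

section \<open>Simulating three counters in linear space\<close>

text \<open>This links size bounds on a counter with the individual cells that hold its
  bits.\<close>

lemma nat_less_power_iff: "(v::nat) < 2 ^ k \<longleftrightarrow> (\<forall>n. bit v n \<longrightarrow> n < k)"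
proof -
  have "v < 2 ^ k \<longleftrightarrow> take_bit k v = v" by (simp add: take_bit_nat_eq_self_iff)
  also have "\<dots> \<longleftrightarrow> (\<forall>n. bit v n \<longrightarrow> n < k)" by (auto simp: bit_eq_iff bit_take_bit_iff)
  finally show ?thesis .
qed

lemma add_power_eq_set_bit: "\<not> bit (v::nat) j \<Longrightarrow> v + 2 ^ j = set_bit j v"
  by (simp add: set_bit_eq)

lemma diff_power_eq_unset_bit: "bit (v::nat) j \<Longrightarrow> v - 2 ^ j = unset_bit j v"
proof -
  assume b: "bit v j"
  have "unset_bit j v + 2 ^ j = set_bit j (unset_bit j v)"
    by (rule add_power_eq_set_bit) (simp add: bit_unset_bit_iff)
  also have "\<dots> = v" using b by (intro bit_eqI) (auto simp: bit_unset_bit_iff bit_set_bit_iff)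
  finally show ?thesis by simp
qed

lemma power_le_if_bit: "bit (v::nat) j \<Longrightarrow> 2 ^ j \<le> v"
  by (meson nat_less_power_iff not_le less_irrefl)

lemma binary_nth: "i < length (binary n) \<Longrightarrow> binary n ! i = Digit (bit n (length (binary n) - 1 - i))"
proof (induction n arbitrary: i rule: less_induct)
  case (less n)
  show ?case
  proof (cases "n < 2")
    case True
    with less.prems show ?thesis by (simp add: binary_less_2 bit_0)
  next
    case False
    show ?thesis
    proof (cases "i = length (binary (n div 2))")
      case True
      with False show ?thesis by (simp add: binary_ge_2 bit_0)
    next
      case ne: False
      with False less.prems have i: "i < length (binary (n div 2))" by (simp add: binary_ge_2)
      then have "length (binary (n div 2)) - i = Suc (length (binary (n div 2)) - 1 - i)" by simp
      with i False less.IH[of "n div 2" i] show ?thesis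
        by (simp add: binary_ge_2 nth_append bit_Suc)
    qed
  qed
qed

lemma length_binary_eq:
  assumes "2 ^ k \<le> z" "z < 2 ^ Suc k" shows "length (binary z) = Suc k"
proof -
  have "(2::nat) ^ k < 2 ^ length (binary z)" using assms(1) less_power_length_binary by (rule le_less_trans)
  then have "k < length (binary z)" by simp
  have "1 \<le> z" using assms(1) by (metis le_trans one_le_numeral one_le_power)
  then have "2 ^ length (binary z) \<le> 2 * z" using length_binary_le[of z] by simp
  also have "\<dots> < 2 ^ Suc (Suc k)" using assms(2) by simp
  finally have "length (binary z) < Suc (Suc k)" by (simp only: power_strict_increasing_iff numeral_less_iff one_less_numeral_iff semiring_norm)
  with \<open>k < length (binary z)\<close> show ?thesis by simp
qed

section \<open>A Turing machine with three counter tracks\<close>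

text \<open>Apart from the counter being worked on, a state remembers the address at which to
  continue, and for a decrement also the jump target in case the counter is 0.\<close>

datatype bst = In0 | In1 | Main nat | SeekInc nat nat | SeekDec nat nat nat | Carry nat nat
  | Borrow nat nat nat | Undo nat nat | Ret nat | Erase | Conv | Strip | Done

instance bst :: countable by countable_datatype

text \<open>A tape cell carries a set: \<open>i < 3\<close> belongs to it iff the cell holds a 1 bit of counter \<open>i\<close>, while
  3 and 4 mark the cells to the right of the least significant bits of counter 0 and of counters 1 and 2.
  So counter 0 can be initialised by reading off \<open>x\<close>, and counter 1 by reading off \<open>y\<close>.\<close>

definition cell :: "nat set \<Rightarrow> symbol" where "cell A = Aux (set_encode A)"

text \<open>A blank cell reads as zero bits on all tracks, so a carry that leaves the written part
  extends it without a special case.\<close>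

fun tracks :: "symbol \<Rightarrow> nat set" where
  "tracks (Aux a) = set_decode a"
| "tracks _ = {}"

lemma tracks_cell [simp]: "finite A \<Longrightarrow> tracks (cell A) = A"
  by (simp add: cell_def)

lemma cell_neq_Blank [simp]: "cell A \<noteq> Blank"
  by (simp add: cell_def)

definition mark :: "nat \<Rightarrow> nat" where "mark i = (if i = 0 then 3 else 4)"

text \<open>Each instruction starts in \<open>Main\<close> with the head on the cell marked 4, and
  \<open>Ret\<close> brings it back there. Seeking ends one cell left of the mark, on the lowest bit
  of the counter.\<close>

fun cm_delta :: "instr list \<Rightarrow> nat \<Rightarrow> bst \<Rightarrow> symbol \<Rightarrow> bst \<times> symbol \<times> move" where
  "cm_delta P r In0 s = (case s of Digit d \<Rightarrow> (In0, cell (if d then {0} else {}), MRight)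
     | _ \<Rightarrow> (In1, cell {3}, MRight))"
| "cm_delta P r In1 s = (case s of Digit d \<Rightarrow> (In1, cell (if d then {1} else {}), MRight)
     | _ \<Rightarrow> (Main 0, cell {4}, MStay))"
| "cm_delta P r (Main pc) s = ((if pc < length P then (case P ! pc of
       Inc i \<Rightarrow> SeekInc i (Suc pc) | Dec i l \<Rightarrow> SeekDec i (Suc pc) l | Jump l \<Rightarrow> Main l | Halt \<Rightarrow> Erase)
     else Done), s, MStay)"
| "cm_delta P r (SeekInc i n) s = (if mark i \<in> tracks s then Carry i n else SeekInc i n, s, MLeft)"
| "cm_delta P r (SeekDec i n l) s = (if mark i \<in> tracks s then Borrow i n l else SeekDec i n l, s, MLeft)"
| "cm_delta P r (Carry i n) s = (if i \<in> tracks s then (Carry i n, cell (tracks s - {i}), MLeft)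
     else (Ret n, cell (insert i (tracks s)), MRight))"
| "cm_delta P r (Borrow i n l) s = (if s = Blank then (Undo i l, s, MRight)
     else if i \<in> tracks s then (Ret n, cell (tracks s - {i}), MRight)
     else (Borrow i n l, cell (insert i (tracks s)), MLeft))"
| "cm_delta P r (Undo i l) s = (if mark i \<in> tracks s then (Ret l, s, MStay)
     else (Undo i l, cell (tracks s - {i}), MRight))"
| "cm_delta P r (Ret n) s = (if 4 \<in> tracks s then (Main n, s, MStay) else (Ret n, s, MRight))"
| "cm_delta P r Erase s = (if mark r \<in> tracks s then Conv else Erase, Blank, MLeft)"
| "cm_delta P r Conv s = (if s = Blank then (Strip, Blank, MRight) else (Conv, Digit (r \<in> tracks s), MLeft))"
| "cm_delta P r Strip s = (case s of Digit d \<Rightarrow> if d then (Done, s, MStay) else (Strip, Blank, MRight)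
     | _ \<Rightarrow> (Done, Digit False, MStay))"
| "cm_delta P r Done s = (Done, s, MStay)"

fun bst_ok :: "nat \<Rightarrow> bst \<Rightarrow> bool" where
  "bst_ok k (Main n) \<longleftrightarrow> n \<le> k"
| "bst_ok k (Ret n) \<longleftrightarrow> n \<le> k"
| "bst_ok k (SeekInc i n) \<longleftrightarrow> i < 3 \<and> n \<le> k"
| "bst_ok k (Carry i n) \<longleftrightarrow> i < 3 \<and> n \<le> k"
| "bst_ok k (Undo i n) \<longleftrightarrow> i < 3 \<and> n \<le> k"
| "bst_ok k (SeekDec i n l) \<longleftrightarrow> i < 3 \<and> n \<le> k \<and> l \<le> k"
| "bst_ok k (Borrow i n l) \<longleftrightarrow> i < 3 \<and> n \<le> k \<and> l \<le> k"
| "bst_ok k _ \<longleftrightarrow> True"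

lemma finite_bst_ok: "finite {q. bst_ok k q}"
proof -
  let ?S = "{In0, In1, Erase, Conv, Strip, Done} \<union> Main ` {..k} \<union> Ret ` {..k} \<union>
       case_prod SeekInc ` ({..<3} \<times> {..k}) \<union> case_prod Carry ` ({..<3} \<times> {..k}) \<union>
       case_prod Undo ` ({..<3} \<times> {..k}) \<union>
       (\<Union>i<3. case_prod (SeekDec i) ` ({..k} \<times> {..k})) \<union> (\<Union>i<3. case_prod (Borrow i) ` ({..k} \<times> {..k}))"
  have "q \<in> ?S" if "bst_ok k q" for q
    using that by (cases q) (auto intro: image_eqI[where x = "(_, _)"])
  then have "{q. bst_ok k q} \<subseteq> ?S" by blast
  then show ?thesis by (rule finite_subset) auto
qed

definition cm_tm :: "instr list \<Rightarrow> nat \<Rightarrow> tm" where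
  "cm_tm P r = \<lparr>
     tm_states = to_nat ` {q. bst_ok (length P) q},
     tm_symbols = {Blank, Digit False, Digit True, Sep} \<union> cell ` Pow {..4},
     tm_start = to_nat In0, tm_halt = to_nat Done,
     tm_delta = (\<lambda>q s. case cm_delta P r (from_nat q) s of (q', s', d) \<Rightarrow> (to_nat q', s', d))\<rparr>"

lemma turing_machine_cm_tm:
  assumes P: "counter_program 3 P"
  shows "turing_machine (cm_tm P r)"
proof -
  have fin: "finite A" if "A \<subseteq> {..4::nat}" for A using that finite_subset by blast
  have sym: "tracks s \<subseteq> {..4}" if "s \<in> tm_symbols (cm_tm P r)" for s
    using that fin by (auto simp: cm_tm_def)
  have cell: "A \<subseteq> {..4} \<Longrightarrow> cell A \<in> tm_symbols (cm_tm P r)" for A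
    by (auto simp: cm_tm_def)
  have bl: "{Blank, Digit False, Digit True, Sep} \<subseteq> tm_symbols (cm_tm P r)"
    by (auto simp: cm_tm_def)
  have ok: "instr_ok 3 (length P) (P ! pc)" if "pc < length P" for pc
    using P that by (auto simp: counter_program_def)
  have step: "bst_ok (length P) q' \<and> s' \<in> tm_symbols (cm_tm P r)"
    if q: "bst_ok (length P) q" and s: "s \<in> tm_symbols (cm_tm P r)" and d: "cm_delta P r q s = (q', s', d)"
    for q s q' s' d
  proof (cases "\<exists>pc. q = Main pc")
    case True
    then obtain pc where pc: "q = Main pc" by blast
    with d q s ok[of pc] show ?thesis by (auto split: if_splits instr.splits)
  next
    case False
    have "Digit e \<in> tm_symbols (cm_tm P r)" for e using bl by (cases e) auto
    with False d q s sym[OF s] bl show ?thesis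
      by (cases q) (auto split: if_splits symbol.splits intro!: cell)
  qed
  show ?thesis
    unfolding turing_machine_def
  proof (intro conjI ballI)
    fix q s assume q: "q \<in> tm_states (cm_tm P r)" and s: "s \<in> tm_symbols (cm_tm P r)"
    then obtain q0 where q0: "q = to_nat q0" "bst_ok (length P) q0" by (auto simp: cm_tm_def)
    obtain q' s' d where d: "cm_delta P r q0 s = (q', s', d)" by (metis prod_cases3)
    have "tm_delta (cm_tm P r) q s = (to_nat q', s', d)" using d by (simp add: cm_tm_def q0(1))
    then show "case tm_delta (cm_tm P r) q s of (q', b, d) \<Rightarrow> q' \<in> tm_states (cm_tm P r) \<and> b \<in> tm_symbols (cm_tm P r)"
      using step[OF q0(2) s d] by (simp add: cm_tm_def)
  qed (auto simp: cm_tm_def finite_bst_ok)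
qed

text \<open>Success for the Turing machine: it halts with output \<open>u\<close>, and the head
  stays between \<open>a\<close> and \<open>b\<close>, which certifies the space.\<close>

inductive crun :: "instr list \<Rightarrow> nat \<Rightarrow> int \<Rightarrow> int \<Rightarrow> symbol list \<Rightarrow> bst \<Rightarrow> (int \<Rightarrow> symbol) \<Rightarrow> int \<Rightarrow> bool"
  for P r a b u where
  crun_done: "t = tape_of s u \<Longrightarrow> a \<le> h \<Longrightarrow> h \<le> b \<Longrightarrow> crun P r a b u Done t h"
| crun_step: "q \<noteq> Done \<Longrightarrow> a \<le> h \<Longrightarrow> h \<le> b \<Longrightarrow> cm_delta P r q (t h) = (q', s, d) \<Longrightarrow>
    crun P r a b u q' (t(h := s)) (move_head d h) \<Longrightarrow> crun P r a b u q t h"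

lemma crun_stay:
  assumes "cm_delta P r q (t h) = (q', t h, d)" "q \<noteq> Done" "a \<le> h" "h \<le> b" "crun P r a b u q' t (move_head d h)"
  shows "crun P r a b u q t h"
  by (rule crun_step[where q = q and q' = q' and s = "t h" and d = d]) (use assms in auto)

text \<open>The second part concerns all reachable configurations. It follows from the one given run
  because each step is determined (\<open>st\<close>) and \<open>Done\<close> has no
  successor.\<close>

lemma crun_tm:
  assumes "crun P r a b u q t h"
  shows "(\<exists>s h'. (tm_step (cm_tm P r))\<^sup>*\<^sup>* (to_nat q, t, h) (tm_halt (cm_tm P r), tape_of s u, h')) \<and>
    (\<forall>c. (tm_step (cm_tm P r))\<^sup>*\<^sup>* (to_nat q, t, h) c \<longrightarrow> snd (snd c) \<in> {a..b})"
  using assms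
proof (induction rule: crun.induct)
  case (crun_done t s h)
  have no: "\<not> tm_step (cm_tm P r) (to_nat Done, t, h) c" for c
    by (auto simp: cm_tm_def elim!: tm_step.cases)
  have "c = (to_nat Done, t, h)" if "(tm_step (cm_tm P r))\<^sup>*\<^sup>* (to_nat Done, t, h) c" for c
    using that no by (metis converse_rtranclpE)
  moreover have "tm_halt (cm_tm P r) = to_nat Done" by (simp add: cm_tm_def)
  ultimately show ?case using crun_done by (metis atLeastAtMost_iff rtranclp.rtrancl_refl snd_conv)
next
  case (crun_step q h t q' s d)
  let ?S = "tm_step (cm_tm P r)"
  have nh: "to_nat q \<noteq> tm_halt (cm_tm P r)" using crun_step.hyps(1) by (simp add: cm_tm_def)
  have del: "tm_delta (cm_tm P r) (to_nat q) (t h) = (to_nat q', s, d)"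
    using crun_step.hyps by (simp add: cm_tm_def)
  have st: "?S (to_nat q, t, h) c \<longleftrightarrow> c = (to_nat q', t(h := s), move_head d h)" for c
    using del nh by (auto elim!: tm_step.cases intro: tm_step.intros)
  have "snd (snd c) \<in> {a..b}" if "?S\<^sup>*\<^sup>* (to_nat q, t, h) c" for c
    using that
  proof (cases rule: converse_rtranclpE)
    case base
    then show ?thesis using crun_step.hyps by auto
  next
    case (step c')
    then show ?thesis using crun_step.IH unfolding st by blast
  qed
  moreover have "\<exists>s h'. ?S\<^sup>*\<^sup>* (to_nat q, t, h) (tm_halt (cm_tm P r), tape_of s u, h')"
    using crun_step.IH converse_rtranclp_into_rtranclp[of ?S, OF iffD2[OF st refl]] by blast
  ultimately show ?case by blast
qed

section \<open>Tape layout and changes of a single bit\<close>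

text \<open>\<open>lx\<close> will be the cell of the separator, \<open>H\<close> the first cell
  behind the input, and \<open>m\<close> the distance by which the counters may extend to the left
  of 0. The limit \<open>- int m - 1\<close> of \<open>run\<close> leaves room for one blank cell,
  onto which a failing borrow and the final conversion step.\<close>

locale counter_tape =
  fixes P :: "instr list" and r :: nat and lx H :: int and m :: nat and u :: "symbol list"
  assumes lx: "0 \<le> lx" "lx < H"
begin

abbreviation "run \<equiv> crun P r (- int m - 1) H u"

definition pos :: "nat \<Rightarrow> int" where "pos i = (if i = 0 then lx else H)"

definition cells :: "(nat \<Rightarrow> nat) \<Rightarrow> int \<Rightarrow> nat set" where
  "cells v p = {i. i < 3 \<and> p < pos i \<and> bit (v i) (nat (pos i - 1 - p))} \<union>
     (if p = lx then {3} else {}) \<union> (if p = H then {4} else {})"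

text \<open>\<open>lo\<close> is the left end of the written part. It is not determined by the
  counters: a counter that shrinks leaves cells with zero bits behind, and these differ from
  \<open>Blank\<close>.\<close>

definition tape :: "(nat \<Rightarrow> nat) \<Rightarrow> int \<Rightarrow> int \<Rightarrow> symbol" where
  "tape v lo p = (if lo \<le> p \<and> p \<le> H then cell (cells v p) else Blank)"

definition fits :: "(nat \<Rightarrow> nat) \<Rightarrow> int \<Rightarrow> bool" where
  "fits v lo \<longleftrightarrow> - int m \<le> lo \<and> lo \<le> 0 \<and> (\<forall>i<3. v i < 2 ^ nat (pos i - lo))"

lemma pos: "0 \<le> pos i" "pos i \<le> H" "lo \<le> 0 \<Longrightarrow> lo \<le> pos i"
  using lx by (auto simp: pos_def)

lemma finite_cells [simp]: "finite (cells v p)"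
proof -
  have "cells v p \<subseteq> {..4}" by (auto simp: cells_def split: if_splits)
  then show ?thesis using finite_subset by blast
qed

lemma mark_cells: "mark i \<in> cells v p \<longleftrightarrow> p = pos i"
  by (auto simp: cells_def mark_def pos_def)

lemma track_cells: "i < 3 \<Longrightarrow> p = pos i - 1 - int j \<Longrightarrow> i \<in> cells v p \<longleftrightarrow> bit (v i) j"
  by (auto simp: cells_def)

lemma cells_below:
  assumes "fits v lo" "p < lo" shows "cells v p = {}"
proof -
  have "\<not> bit (v i) (nat (pos i - 1 - p))" if "i < 3" for i
  proof
    assume "bit (v i) (nat (pos i - 1 - p))"
    then have "nat (pos i - 1 - p) < nat (pos i - lo)"
      using assms(1) that nat_less_power_iff unfolding fits_def by blast
    then show False using assms(2) by linarith
  qed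
  moreover have "p < 0" using assms by (auto simp: fits_def)
  ultimately show ?thesis using lx by (auto simp: cells_def)
qed

lemma tracks_tape: "fits v lo \<Longrightarrow> p \<le> H \<Longrightarrow> tracks (tape v lo p) = cells v p"
  using cells_below[of v lo p] by (auto simp: tape_def)

text \<open>\<open>Carry\<close>, \<open>Borrow\<close> and \<open>Undo\<close> all change just bit
  \<open>j\<close> of one counter. The case \<open>p = lo - 1\<close> is a carry that opens a new
  cell.\<close>

lemma tape_update:
  assumes v: "fits v lo" and i: "i < 3" and p: "p = pos i - 1 - int j" "lo - 1 \<le> p"
    and bits: "\<And>k. k \<noteq> j \<Longrightarrow> bit x k \<longleftrightarrow> bit (v i) k"
    and A: "A = (if bit x j then insert i (cells v p) else cells v p - {i})"
  shows "(tape v lo)(p := cell A) = tape (v(i := x)) (min lo p)"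
proof
  fix q
  have pH: "p \<le> H" using pos(2)[of i] p by linarith
  show "((tape v lo)(p := cell A)) q = tape (v(i := x)) (min lo p) q"
  proof (cases "q = p")
    case True
    have "cells (v(i := x)) p = A"
      using i pos[of i] lx unfolding A cells_def p(1)
      by (auto simp: pos_def split: if_splits)
    with True pH show ?thesis by (simp add: tape_def)
  next
    case False
    have "bit x (nat (pos i - 1 - q)) \<longleftrightarrow> bit (v i) (nat (pos i - 1 - q))" if "q < pos i"
      using that False p(1) by (intro bits) auto
    then have "cells (v(i := x)) q = cells v q" by (auto simp: cells_def)
    with False p(2) show ?thesis by (auto simp: tape_def)
  qed
qed

lemma fits_update:
  assumes v: "fits v lo" and i: "i < 3" and p: "p = pos i - 1 - int j" "lo - 1 \<le> p" "- int m \<le> p"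
    and bits: "\<And>k. bit x k \<Longrightarrow> k = j \<or> bit (v i) k"
  shows "fits (v(i := x)) (min lo p)"
proof -
  have "x < 2 ^ nat (pos i - min lo p)"
    unfolding nat_less_power_iff
  proof (intro allI impI)
    fix k assume "bit x k"
    then have "k = j \<or> k < nat (pos i - lo)"
      using bits v i nat_less_power_iff unfolding fits_def by blast
    then show "k < nat (pos i - min lo p)" using p by auto
  qed
  moreover have "v k < 2 ^ nat (pos k - min lo p)" if "k < 3" for k
  proof -
    have "v k < 2 ^ nat (pos k - lo)" using v that by (simp add: fits_def)
    also have "\<dots> \<le> 2 ^ nat (pos k - min lo p)" by (intro power_increasing) auto
    finally show ?thesis .
  qed
  ultimately show ?thesis using v p by (auto simp: fits_def)
qed

section \<open>Increment and decrement by carries and borrows\<close>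

lemma run_Seek:
  assumes v: "fits v lo" and q: "q = SeekInc i n \<and> q' = Carry i n \<or> q = SeekDec i n l \<and> q' = Borrow i n l"
    and cont: "run q' (tape v lo) (pos i - 1)" and p: "pos i \<le> p" "p \<le> H"
  shows "run q (tape v lo) p"
  using p
proof (induction "nat (p - pos i)" arbitrary: p)
  case 0
  then have "p = pos i" by simp
  then show ?case using 0 q cont pos(1)[of i]
    by (rule_tac crun_stay[of _ _ q _ _ q' MLeft]) (auto simp: tracks_tape[OF v] mark_cells)
next
  case (Suc k)
  have "run q (tape v lo) (p - 1)" using Suc by (intro Suc.hyps(1)) auto
  then show ?case using Suc q pos(1)[of i]
    by (rule_tac crun_stay[of _ _ q _ _ q MLeft]) (auto simp: tracks_tape[OF v] mark_cells)
qed

lemma run_Ret: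
  assumes v: "fits v lo" and cont: "run (Main n) (tape v lo) H" and p: "lo \<le> p" "p \<le> H"
  shows "run (Ret n) (tape v lo) p"
  using p
proof (induction "nat (H - p)" arbitrary: p)
  case 0
  then have "p = H" by simp
  then show ?case using 0 cont v mark_cells[of 1 v H] lx
    by (rule_tac crun_stay[of _ _ "Ret n" _ _ "Main n" MStay]) (auto simp: tracks_tape[OF v] mark_def pos_def fits_def)
next
  case (Suc k)
  have "run (Ret n) (tape v lo) (p + 1)" using Suc by (intro Suc.hyps(1)) auto
  then show ?case using Suc v mark_cells[of 1 v p]
    by (rule_tac crun_stay[of _ _ "Ret n" _ _ "Ret n" MRight]) (auto simp: tracks_tape[OF v] mark_def pos_def fits_def)
qed

text \<open>In state \<open>Carry i n\<close> at bit \<open>j\<close>, counter \<open>i\<close> plus \<open>2 ^ j\<close> is invariant; in state \<open>Borrow i n l\<close>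
  it is counter \<open>i\<close> minus \<open>2 ^ j\<close>.\<close>

lemma run_Carry:
  assumes i: "i < 3" and v: "fits v lo" and p: "p = pos i - 1 - int j" "lo - 1 \<le> p"
    and x: "x = v i + 2 ^ j" "x < 2 ^ m"
    and cont: "\<And>lo. fits (v(i := x)) lo \<Longrightarrow> run (Main n) (tape (v(i := x)) lo) H"
  shows "run (Carry i n) (tape v lo) p"
  using v p x cont
proof (induction "m - j" arbitrary: v p j lo rule: less_induct)
  case less
  \<comment> \<open>The sum being formed is below \<open>2 ^ m\<close>, so the carry stops before
    bit \<open>m\<close>; this keeps the head in the permitted interval.\<close>
  have "2 ^ j < (2::nat) ^ m" using less.prems(4,5) by linarith
  then have j: "j < m" by simp
  have pm: "- int m \<le> p" "p < H" using j less.prems pos[of i] by auto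
  have tr: "tracks (tape v lo p) = cells v p" using pm by (intro tracks_tape less.prems) simp
  have mem: "i \<in> cells v p \<longleftrightarrow> bit (v i) j" by (rule track_cells[OF i less.prems(2)])
  show ?case
  proof (cases "bit (v i) j")
    case True
    let ?y = "unset_bit j (v i)"
    have y: "?y + 2 ^ Suc j = x"
      using diff_power_eq_unset_bit[OF True] power_le_if_bit[OF True] less.prems(4) by simp
    have lop: "lo \<le> p"
    proof (rule ccontr)
      assume "\<not> lo \<le> p"
      then have "cells v p = {}" using less.prems(1) by (intro cells_below) auto
      then show False using mem True by auto
    qed
    have t: "(tape v lo)(p := cell (cells v p - {i})) = tape (v(i := ?y)) lo"
      using tape_update[OF less.prems(1) i less.prems(2,3), of ?y] lop
      by (simp add: bit_unset_bit_iff min_absorb1)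
    have f: "fits (v(i := ?y)) lo"
      using fits_update[OF less.prems(1) i less.prems(2,3) pm(1), of ?y] lop
      by (simp add: bit_unset_bit_iff min_absorb1)
    have "run (Carry i n) (tape (v(i := ?y)) lo) (p - 1)"
      by (rule less.hyps[where j = "Suc j", OF _ f]) (use j lop less.prems y in auto)
    then show ?thesis using pm mem True t
      by (rule_tac crun_step[of "Carry i n" _ _ _ _ _ _ "Carry i n" "cell (cells v p - {i})" MLeft]) (auto simp: tr)
  next
    case False
    have sx: "x = set_bit j (v i)" using add_power_eq_set_bit[OF False] less.prems(4) by simp
    have t: "(tape v lo)(p := cell (insert i (cells v p))) = tape (v(i := x)) (min lo p)"
      using tape_update[OF less.prems(1) i less.prems(2,3), of x] unfolding sx
      by (simp add: bit_set_bit_iff)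
    have f: "fits (v(i := x)) (min lo p)"
      using fits_update[OF less.prems(1) i less.prems(2,3) pm(1), of x] unfolding sx
      by (auto simp add: bit_set_bit_iff)
    have "run (Ret n) (tape (v(i := x)) (min lo p)) (p + 1)"
      using pm by (intro run_Ret f less.prems(6)) auto
    then show ?thesis using pm mem False t
      by (rule_tac crun_step[of "Carry i n" _ _ _ _ _ _ "Ret n" "cell (insert i (cells v p))" MRight]) (auto simp: tr)
  qed
qed

text \<open>The equation \<open>v i = x + 2 ^ j\<close> states without truncated subtraction that
  the borrow succeeds: some bit from \<open>j\<close> on is 1, and it lies in the written
  part.\<close>

lemma run_Borrow_pos:
  assumes i: "i < 3" and v: "fits v lo" and p: "p = pos i - 1 - int j"
    and x: "v i = x + 2 ^ j"
    and cont: "\<And>lo. fits (v(i := x)) lo \<Longrightarrow> run (Main n) (tape (v(i := x)) lo) H"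
  shows "run (Borrow i n l) (tape v lo) p"
  using v p x cont
proof (induction "nat (p + int m + 1)" arbitrary: v p j rule: less_induct)
  case less
  have "2 ^ j < (2::nat) ^ nat (pos i - lo)"
    using less.prems(1,3) i by (metis fits_def le_add2 le_less_trans)
  then have "j < nat (pos i - lo)" by simp
  then have lop: "lo \<le> p" using less.prems(2) by linarith
  then have pm: "- int m \<le> p" "p < H" using less.prems pos[of i] by (auto simp: fits_def)
  have tr: "tracks (tape v lo p) = cells v p" using pm by (intro tracks_tape less.prems) simp
  have nb: "tape v lo p \<noteq> Blank" using lop pm by (simp add: tape_def)
  have mem: "i \<in> cells v p \<longleftrightarrow> bit (v i) j" by (rule track_cells[OF i less.prems(2)])
  show ?case
  proof (cases "bit (v i) j")
    case True
    have x: "x = unset_bit j (v i)" using diff_power_eq_unset_bit[OF True] less.prems(3) by simp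
    have t: "(tape v lo)(p := cell (cells v p - {i})) = tape (v(i := x)) lo"
      using tape_update[OF less.prems(1) i less.prems(2), of x] lop unfolding x
      by (simp add: bit_unset_bit_iff min_absorb1)
    have f: "fits (v(i := x)) lo"
      using fits_update[OF less.prems(1) i less.prems(2) _ pm(1), of x] lop unfolding x
      by (simp add: bit_unset_bit_iff min_absorb1)
    have "run (Ret n) (tape (v(i := x)) lo) (p + 1)"
      using pm lop by (intro run_Ret f less.prems(4)) auto
    then show ?thesis using pm mem True t nb
      by (rule_tac crun_step[of "Borrow i n l" _ _ _ _ _ _ "Ret n" "cell (cells v p - {i})" MRight]) (auto simp: tr)
  next
    case False
    let ?y = "set_bit j (v i)"
    have y: "?y = x + 2 ^ Suc j" using add_power_eq_set_bit[OF False] less.prems(3) by simp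
    have t: "(tape v lo)(p := cell (insert i (cells v p))) = tape (v(i := ?y)) lo"
      using tape_update[OF less.prems(1) i less.prems(2), of ?y] lop
      by (simp add: bit_set_bit_iff min_absorb1)
    have f: "fits (v(i := ?y)) lo"
      using fits_update[OF less.prems(1) i less.prems(2) _ pm(1), of ?y] lop
      by (auto simp: bit_set_bit_iff min_absorb1)
    have "run (Borrow i n l) (tape (v(i := ?y)) lo) (p - 1)"
      by (rule less.hyps[where j = "Suc j", OF _ f]) (use pm less.prems y in auto)
    then show ?thesis using pm mem False t nb
      by (rule_tac crun_step[of "Borrow i n l" _ _ _ _ _ _ "Borrow i n l" "cell (insert i (cells v p))" MLeft])
        (auto simp: tr)
  qed
qed

text \<open>A borrow that reaches the blank part of the tape reveals that the counter was 0; it has then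
  turned all its bits into 1, which \<open>Undo\<close> clears again.\<close>

lemma run_Undo:
  assumes i: "i < 3" and v: "fits v lo" and p: "p = pos i - int j" "lo \<le> p" and x: "v i < 2 ^ j"
    and cont: "run (Main l) (tape (v(i := 0)) lo) H"
  shows "run (Undo i l) (tape v lo) p"
  using v p x cont
proof (induction j arbitrary: v p)
  case 0
  then have v0: "v(i := 0) = v" by auto
  have "run (Ret l) (tape v lo) p"
    using 0 pos(2)[of i] unfolding v0 by (intro run_Ret) auto
  then show ?case using 0 pos[of i]
    by (rule_tac crun_stay[of _ _ "Undo i l" _ _ "Ret l" MStay]) (auto simp: tracks_tape[OF 0(1)] mark_cells)
next
  case (Suc j)
  let ?y = "unset_bit j (v i)"
  have p: "p = pos i - 1 - int j" using Suc.prems by simp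
  have pm: "- int m \<le> p" "p < H" "lo - 1 \<le> p" using Suc.prems pos[of i] by (auto simp: fits_def)
  have tr: "tracks (tape v lo p) = cells v p" using pm by (intro tracks_tape Suc.prems) simp
  have t: "(tape v lo)(p := cell (cells v p - {i})) = tape (v(i := ?y)) lo"
    using tape_update[OF Suc.prems(1) i p pm(3), of ?y] Suc.prems(3)
    by (simp add: bit_unset_bit_iff min_absorb1)
  have f: "fits (v(i := ?y)) lo"
    using fits_update[OF Suc.prems(1) i p pm(3,1), of ?y] Suc.prems(3)
    by (simp add: bit_unset_bit_iff min_absorb1)
  have "?y < 2 ^ j"
    using Suc.prems(4) unfolding nat_less_power_iff by (auto simp: bit_unset_bit_iff less_Suc_eq)
  then have y: "(v(i := ?y)) i < 2 ^ j" by simp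
  have cont': "run (Main l) (tape ((v(i := ?y))(i := 0)) lo) H"
    using Suc.prems(5) by (simp only: fun_upd_upd)
  have p': "p + 1 = pos i - int j" "lo \<le> p + 1" using Suc.prems(2,3) by auto
  have "run (Undo i l) (tape (v(i := ?y)) lo) (p + 1)"
    by (rule Suc.IH[OF f p' y cont'])
  moreover have "mark i \<notin> cells v p" using p by (simp add: mark_cells)
  ultimately show ?case using pm(1,2) t
    by (rule_tac crun_step[of "Undo i l" _ _ _ _ _ _ "Undo i l" "cell (cells v p - {i})" MRight])
      (auto simp: tr)
qed

text \<open>\<open>v i < 2 ^ j\<close> means that all bits from \<open>j\<close> on are 0, so each
  is set until the blank is met. The contents of counter \<open>i\<close> are spoilt meanwhile; the
  continuation is therefore stated for \<open>v(i := 0)\<close>, which every round leaves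
  unchanged.\<close>

lemma run_Borrow_zero:
  assumes i: "i < 3" and v: "fits v lo" and p: "p = pos i - 1 - int j" "lo - 1 \<le> p"
    and x: "v i < 2 ^ j" and cont: "run (Main l) (tape (v(i := 0)) lo) H"
  shows "run (Borrow i n l) (tape v lo) p"
  using v p x cont
proof (induction "nat (p + int m + 1)" arbitrary: v p j rule: less_induct)
  case less
  have pm: "- int m - 1 \<le> p" "p < H" using less.prems pos[of i] by (auto simp: fits_def)
  show ?case
  proof (cases "lo \<le> p")
    case True
    have tr: "tracks (tape v lo p) = cells v p" using pm by (intro tracks_tape less.prems) simp
    have nb: "tape v lo p \<noteq> Blank" using True pm by (simp add: tape_def)
    have mem: "i \<in> cells v p \<longleftrightarrow> bit (v i) j" by (rule track_cells[OF i less.prems(2)])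
    have nbit: "\<not> bit (v i) j" using less.prems(4) by (auto simp: nat_less_power_iff)
    have pm': "- int m \<le> p" using less.prems(1) True by (simp add: fits_def)
    let ?y = "set_bit j (v i)"
    have y: "?y < 2 ^ Suc j" using add_power_eq_set_bit[OF nbit] less.prems(4) by simp
    have t: "(tape v lo)(p := cell (insert i (cells v p))) = tape (v(i := ?y)) lo"
      using tape_update[OF less.prems(1) i less.prems(2,3), of ?y] True
      by (simp add: bit_set_bit_iff min_absorb1)
    have f: "fits (v(i := ?y)) lo"
      using fits_update[OF less.prems(1) i less.prems(2,3) pm', of ?y] True
      by (auto simp: bit_set_bit_iff min_absorb1)
    have "run (Borrow i n l) (tape (v(i := ?y)) lo) (p - 1)"
      by (rule less.hyps[where j = "Suc j", OF _ f]) (use pm pm' True less.prems y in auto)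
    then show ?thesis using pm mem nbit t nb
      by (rule_tac crun_step[of "Borrow i n l" _ _ _ _ _ _ "Borrow i n l" "cell (insert i (cells v p))" MLeft])
        (auto simp: tr)
  next
    case False
    then have "tape v lo p = Blank" by (simp add: tape_def)
    moreover have "run (Undo i l) (tape v lo) (p + 1)"
      using less.prems False by (intro run_Undo[OF i]) auto
    ultimately show ?thesis using pm
      by (rule_tac crun_stay[of _ _ "Borrow i n l" _ _ "Undo i l" MRight]) auto
  qed
qed

end

context counter_tape begin

section \<open>Producing the output\<close>

text \<open>The leftmost 1 bit determines the length of \<open>binary z\<close>, and from there on
  the tape is exactly this numeral. Without a 1 bit everything is erased, the head arrives at
  \<open>pos r\<close>, and the digit 0 has to be written.\<close>

lemma run_Strip:
  assumes u: "u = binary z" and z: "z < 2 ^ nat (pos r - q)" and q: "- int m \<le> q" "q \<le> pos r"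
  shows "run Strip (\<lambda>x. if q \<le> x \<and> x < pos r then Digit (bit z (nat (pos r - 1 - x))) else Blank) q"
  using z q
proof (induction "nat (pos r - q)" arbitrary: q)
  case 0
  then have q: "q = pos r" "z = 0" by auto
  have "(\<lambda>x. if q \<le> x \<and> x < pos r then Digit (bit z (nat (pos r - 1 - x))) else Blank)(q := Digit False) = tape_of q u"
    unfolding u q by (auto simp: fun_eq_iff tape_of_def binary_less_2)
  then have "run Done ((\<lambda>x. if q \<le> x \<and> x < pos r then Digit (bit z (nat (pos r - 1 - x))) else Blank)(q := Digit False)) q"
    using 0 pos(2)[of r] by (intro crun_done) auto
  then show ?case using 0 pos(2)[of r] q
    by (rule_tac crun_step[of Strip _ _ _ _ _ _ Done "Digit False" MStay]) auto
next
  case (Suc k)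
  let ?t = "\<lambda>q x. if q \<le> x \<and> x < pos r then Digit (bit z (nat (pos r - 1 - x))) else Blank"
  have k: "nat (pos r - 1 - q) = k" "int k = pos r - 1 - q" using Suc.hyps(2) by auto
  have qH: "q \<le> H" "q < pos r" using Suc pos(2)[of r] by auto
  have tq: "?t q q = Digit (bit z k)" using qH k by auto
  show ?case
  proof (cases "bit z k")
    case True
    have "length (binary z) = Suc k"
      using Suc.prems(1) Suc.hyps(2) power_le_if_bit[OF True] by (intro length_binary_eq) simp_all
    then have len: "length u = Suc k" using u by simp
    have "?t q = tape_of q u"
    proof
      fix x
      show "?t q x = tape_of q u x"
      proof (cases "q \<le> x \<and> x < pos r")
        case True
        then have "nat (x - q) < length (binary z)" "k - nat (x - q) = nat (pos r - 1 - x)"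
          "x < q + int (length u)"
          using k len u by auto
        then show ?thesis using True binary_nth[of "nat (x - q)" z] len by (simp add: tape_of_def u)
      next
        case False
        then show ?thesis using k len by (auto simp: tape_of_def)
      qed
    qed
    then have "run Done (?t q) q" using Suc.prems qH by (intro crun_done) auto
    then show ?thesis using qH Suc.prems(2) tq True
      by (rule_tac crun_stay[of _ _ Strip _ _ Done MStay]) auto
  next
    case False
    have "z < 2 ^ nat (pos r - (q + 1))"
      unfolding nat_less_power_iff
    proof (intro allI impI)
      fix n assume n: "bit z n"
      then have "n < nat (pos r - q)" using Suc.prems(1) nat_less_power_iff by blast
      moreover have "n \<noteq> k" using n False by auto
      ultimately show "n < nat (pos r - (q + 1))" using k by linarith
    qed
    then have "run Strip (?t (q + 1)) (q + 1)" using Suc qH by (intro Suc.hyps(1)) auto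
    moreover have "(?t q)(q := Blank) = ?t (q + 1)" by (auto simp: fun_eq_iff)
    ultimately show ?thesis using qH Suc.prems(2) tq False
      by (rule_tac crun_step[of Strip _ _ _ _ _ _ Strip Blank MRight]) auto
  qed
qed

text \<open>Cells right of \<open>p\<close> are digits already. If the output counter is 1 or 2, the
  cell marked 3 is converted like every other, since only the bit of track \<open>r\<close>
  matters.\<close>

lemma run_Conv:
  assumes v: "fits v lo" and u: "u = binary (v r)" and r: "r < 3" and p: "lo - 1 \<le> p" "p < pos r"
  shows "run Conv (\<lambda>x. if p < x \<and> x < pos r then Digit (bit (v r) (nat (pos r - 1 - x)))
    else if x \<le> p then tape v lo x else Blank) p"
  using p
proof (induction "nat (p - lo + 1)" arbitrary: p)
  case 0
  then have p: "p = lo - 1" by simp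
  let ?t = "\<lambda>x. if p < x \<and> x < pos r then Digit (bit (v r) (nat (pos r - 1 - x)))
    else if x \<le> p then tape v lo x else Blank"
  have lo: "- int m \<le> lo" "lo \<le> 0" "v r < 2 ^ nat (pos r - lo)" using v r by (auto simp: fits_def)
  have "run Strip (\<lambda>x. if lo \<le> x \<and> x < pos r then Digit (bit (v r) (nat (pos r - 1 - x))) else Blank) lo"
    using lo pos(3)[of lo r] by (intro run_Strip u) auto
  moreover have "?t = (\<lambda>x. if lo \<le> x \<and> x < pos r then Digit (bit (v r) (nat (pos r - 1 - x))) else Blank)"
    using p by (auto simp: fun_eq_iff tape_def)
  ultimately have "run Strip ?t (p + 1)" using p by simp
  moreover have "?t p = Blank" using p by (simp add: tape_def)
  ultimately show ?case using p lo pos(2)[of r] 0(3)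
    by (rule_tac crun_stay[of _ _ Conv _ _ Strip MRight]) auto
next
  case (Suc k)
  let ?t = "\<lambda>p x. if p < x \<and> x < pos r then Digit (bit (v r) (nat (pos r - 1 - x)))
    else if x \<le> p then tape v lo x else Blank"
  have p: "lo \<le> p" "p \<le> H" "- int m - 1 \<le> p" using Suc pos(2)[of r] v by (auto simp: fits_def)
  have "run Conv (?t (p - 1)) (p - 1)" using Suc p by (intro Suc.hyps(1)) auto
  moreover have "(?t p)(p := Digit (bit (v r) (nat (pos r - 1 - p)))) = ?t (p - 1)"
    using Suc.prems by (auto simp: fun_eq_iff)
  moreover have "r \<in> cells v p \<longleftrightarrow> bit (v r) (nat (pos r - 1 - p))"
    using Suc.prems by (intro track_cells r) auto
  moreover have "?t p p = tape v lo p" by simp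
  moreover have "tape v lo p \<noteq> Blank" using p by (simp add: tape_def)
  ultimately show ?case using p tracks_tape[OF v p(2)]
    by (rule_tac crun_step[of Conv _ _ _ _ _ _ Conv "Digit (bit (v r) (nat (pos r - 1 - p)))" MLeft]) auto
qed

lemma run_Erase:
  assumes v: "fits v lo" and u: "u = binary (v r)" and r: "r < 3"
  shows "run Erase (tape v lo) H"
proof -
  let ?t = "\<lambda>p x. if x \<le> p then tape v lo x else Blank"
  have lo: "lo \<le> 0" "- int m \<le> lo" using v by (auto simp: fits_def)
  have *: "run Erase (?t p) p" if "pos r \<le> p" "p \<le> H" for p
    using that
  proof (induction "nat (p - pos r)" arbitrary: p)
    case 0
    then have p: "p = pos r" by simp
    have "run Conv (\<lambda>x. if p - 1 < x \<and> x < pos r then Digit (bit (v r) (nat (pos r - 1 - x)))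
        else if x \<le> p - 1 then tape v lo x else Blank) (p - 1)"
      using p lo pos(1)[of r] by (intro run_Conv[OF v u r]) auto
    moreover have "(\<lambda>x. if p - 1 < x \<and> x < pos r then Digit (bit (v r) (nat (pos r - 1 - x)))
        else if x \<le> p - 1 then tape v lo x else Blank) = (?t p)(p := Blank)"
      using p by (auto simp: fun_eq_iff)
    moreover have "mark r \<in> cells v p" using p by (simp add: mark_cells)
    ultimately show ?case using 0(3) lo pos(1)[of r] p tracks_tape[OF v 0(3)]
      by (rule_tac crun_step[of Erase _ _ _ _ _ _ Conv Blank MLeft]) auto
  next
    case (Suc k)
    have "run Erase (?t (p - 1)) (p - 1)" using Suc by (intro Suc.hyps(1)) auto
    moreover have "?t (p - 1) = (?t p)(p := Blank)" by (auto simp: fun_eq_iff)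
    moreover have "mark r \<notin> cells v p" using Suc.hyps(2) by (auto simp: mark_cells)
    ultimately show ?case using Suc.prems lo pos(1)[of r] tracks_tape[OF v Suc.prems(2)]
      by (rule_tac crun_step[of Erase _ _ _ _ _ _ Erase Blank MLeft]) auto
  qed
  have "?t H = tape v lo" by (auto simp: fun_eq_iff tape_def)
  with *[of H] pos(2)[of r] show ?thesis by simp
qed

text \<open>The condition \<open>w ! i + n < 2 ^ m\<close> is preserved because a step raises a
  counter by at most 1 and uses up one of the \<open>n\<close> remaining steps. It is what
  \<open>run_Carry\<close> needs to stay within \<open>m\<close> bits.\<close>

lemma run_program:
  assumes P: "counter_program 3 P" and r: "r < 3"
    and "(cm_step P ^^ n) (pc, w) (pc', w')" "cm_halted P (pc', w')" "u = binary (w' ! r)"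
    and "length w = 3" "fits ((!) w) lo" "\<forall>i<3. w ! i + n < 2 ^ m"
  shows "run (Main pc) (tape ((!) w) lo) H"
  using assms(3-)
proof (induction n arbitrary: pc w lo)
  case 0
  then have w: "pc' = pc" "w' = w" by auto
  have "run Erase (tape ((!) w) lo) H" using 0 w r by (intro run_Erase) auto
  then show ?case using 0 w lx
    by (rule_tac crun_stay[of _ _ "Main pc" _ _ Erase MStay]) (auto simp: cm_halted_def)
next
  case (Suc n)
  obtain c1 where c1: "cm_step P (pc, w) c1" "(cm_step P ^^ n) c1 (pc', w')"
    using Suc.prems(1) by (meson relpowp_Suc_E2)
  have ok: "instr_ok 3 (length P) (P ! k)" if "k < length P" for k
    using P that by (auto simp: counter_program_def)
  have pH: "pos i - 1 \<ge> lo - 1" for i using Suc.prems(5) pos(1)[of i] by (simp add: fits_def)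
  have j0: "pos i - 1 = pos i - 1 - int 0" for i by simp
  have upd: "((!) w)(i := x) = (!) (w[i := x])" if "i < 3" for i x
    using that Suc.prems(4) by (auto simp: fun_eq_iff nth_list_update)
  have bnd: "\<forall>k<3. w[i := z] ! k + n < 2 ^ m" if "z \<le> w ! i + 1" "i < 3" for i z
  proof (intro allI impI)
    fix k :: nat assume "k < 3"
    then have k: "w ! k + Suc n < 2 ^ m" using Suc.prems(6) by blast
    show "w[i := z] ! k + n < 2 ^ m"
    proof (cases "k = i")
      case True
      then have "w[i := z] ! k = z" using that(2) Suc.prems(4) by simp
      then show ?thesis using k[unfolded True] that(1) by linarith
    next
      case False
      then have "w[i := z] ! k = w ! k" by simp
      then show ?thesis using k by linarith
    qed
  qed
  from c1(1) show ?case
  proof cases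
    case (inc i)
    have i: "i < 3" using ok[OF inc(2)] inc(3) by simp
    let ?x = "w ! i + 1"
    have "run (Main (Suc pc)) (tape (((!) w)(i := ?x)) lo') H" if "fits (((!) w)(i := ?x)) lo'" for lo'
      unfolding upd[OF i]
      by (rule Suc.IH[OF c1(2)[unfolded inc(1)] Suc.prems(2,3) _ that[unfolded upd[OF i]] bnd[OF _ i]])
        (simp_all add: Suc.prems(4))
    moreover have "w ! i + Suc n < 2 ^ m" using Suc.prems(6) i by blast
    then have "?x < 2 ^ m" by linarith
    ultimately have "run (Carry i (Suc pc)) (tape ((!) w) lo) (pos i - 1)"
      by (intro run_Carry[OF i Suc.prems(5) j0 pH]) simp_all
    then have "run (SeekInc i (Suc pc)) (tape ((!) w) lo) H"
      by (intro run_Seek[OF Suc.prems(5) disjI1[OF conjI[OF refl refl]] _ pos(2) order_refl])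
    then show ?thesis using inc lx
      by (rule_tac crun_stay[of _ _ "Main pc" _ _ "SeekInc i (Suc pc)" MStay]) auto
  next
    case (dec i l)
    have i: "i < 3" using ok[OF dec(2)] dec(3) by simp
    let ?x = "w ! i - 1"
    have "run (Main (Suc pc)) (tape (((!) w)(i := ?x)) lo') H" if "fits (((!) w)(i := ?x)) lo'" for lo'
      unfolding upd[OF i]
      by (rule Suc.IH[OF c1(2)[unfolded dec(1)] Suc.prems(2,3) _ that[unfolded upd[OF i]] bnd[OF _ i]])
        (simp_all add: Suc.prems(4))
    moreover have "w ! i = ?x + 2 ^ 0" using dec(4) by simp
    ultimately have "run (Borrow i (Suc pc) l) (tape ((!) w) lo) (pos i - 1)"
      by (intro run_Borrow_pos[OF i Suc.prems(5) j0])
    then have "run (SeekDec i (Suc pc) l) (tape ((!) w) lo) H"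
      by (intro run_Seek[OF Suc.prems(5) disjI2[OF conjI[OF refl refl]] _ pos(2) order_refl])
    then show ?thesis using dec lx
      by (rule_tac crun_stay[of _ _ "Main pc" _ _ "SeekDec i (Suc pc) l" MStay]) auto
  next
    case (dec_zero i l)
    have i: "i < 3" using ok[OF dec_zero(2)] dec_zero(3) by simp
    have upd0: "((!) w)(i := 0) = (!) w" using dec_zero(4) by auto
    have "run (Main l) (tape ((!) w) lo) H"
      using c1(2) Suc.prems unfolding dec_zero(1) by (intro Suc.IH) (auto intro: Suc_lessD)
    moreover have "w ! i < 2 ^ 0" using dec_zero(4) by simp
    ultimately have "run (Borrow i (Suc pc) l) (tape ((!) w) lo) (pos i - 1)"
      by (intro run_Borrow_zero[OF i Suc.prems(5) j0 pH]) (simp_all only: upd0)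
    then have "run (SeekDec i (Suc pc) l) (tape ((!) w) lo) H"
      by (intro run_Seek[OF Suc.prems(5) disjI2[OF conjI[OF refl refl]] _ pos(2) order_refl])
    then show ?thesis using dec_zero lx
      by (rule_tac crun_stay[of _ _ "Main pc" _ _ "SeekDec i (Suc pc) l" MStay]) auto
  next
    case (jump l)
    have "run (Main l) (tape ((!) w) lo) H"
      using c1(2) Suc.prems unfolding jump(1) by (intro Suc.IH) (auto intro: Suc_lessD)
    then show ?thesis using jump lx
      by (rule_tac crun_stay[of _ _ "Main pc" _ _ "Main l" MStay]) auto
  qed
qed

text \<open>\<open>?J p\<close> is the tape after the cells before \<open>p\<close> have been
  translated in place.\<close>

lemma run_input:
  assumes x: "lx = int (length (binary x))" and y: "H = lx + 1 + int (length (binary y))"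
    and cont: "run (Main 0) (tape ((!) [x, y, 0]) 0) H"
  shows "run In0 (tape_of 0 (tm_input x y)) 0"
proof -
  let ?w = "tm_input x y" and ?v = "(!) [x, y, 0]"
  let ?J = "\<lambda>p q. if q < p then tape ?v 0 q else tape_of 0 ?w q"
  have len: "int (length ?w) = H" using x y by (simp add: tm_input_def)
  have three: "{i. i < 3 \<and> Q i} = (if Q 0 then {0} else {}) \<union> (if Q 1 then {1} else {}) \<union> (if Q 2 then {2} else {})"
    for Q :: "nat \<Rightarrow> bool"
  proof -
    have l: "{i. i < 3} = {0, 1, 2::nat}" by auto
    have "{i. i < 3 \<and> Q i} = {i. i < 3} \<inter> Collect Q" by blast
    also have "\<dots> = (if Q 0 then {0} else {}) \<union> (if Q 1 then {1} else {}) \<union> (if Q 2 then {2} else {})"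
      unfolding l by (simp add: insert_commute)
    finally show ?thesis .
  qed
  have cells: "cells ?v p = (if p < lx \<and> bit x (nat (lx - 1 - p)) then {0} else {}) \<union>
     (if p < H \<and> bit y (nat (H - 1 - p)) then {1} else {}) \<union>
     (if p = lx then {3} else {}) \<union> (if p = H then {4} else {})" for p
    unfolding cells_def three by (simp add: pos_def)
  \<comment> \<open>\<open>y\<close> fits between the separator and \<open>H\<close>, so its track
    is empty on the separator and on the cells of \<open>x\<close>.\<close>
  have ybit: "\<not> bit y (nat (H - 1 - p))" if "p \<le> lx" for p
    using less_power_length_binary[of y] that y unfolding nat_less_power_iff by (auto simp: not_less)
  have J: "(?J p)(p := cell (cells ?v p)) = ?J (p + 1)" if "0 \<le> p" "p \<le> H" for p
    using that by (auto simp: fun_eq_iff tape_def)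
  have In1: "run In1 (?J p) p" if "lx < p" "p \<le> H" for p
    using that
  proof (induction "nat (H - p)" arbitrary: p)
    case 0
    then have p: "p = H" by simp
    have "?J p p = Blank" using len p by (simp add: tape_of_def)
    moreover have "(?J p)(p := cell {4}) = tape ?v 0"
      using lx len p cells[of H] by (auto simp: fun_eq_iff tape_def tape_of_def)
    ultimately show ?case using cont lx p
      by (rule_tac crun_step[of In1 _ _ _ _ _ _ "Main 0" "cell {4}" MStay]) auto
  next
    case (Suc k)
    have p: "lx < p" "p < H" using Suc by auto
    have "run In1 (?J (p + 1)) (p + 1)" using Suc p by (intro Suc.hyps(1)) auto
    then have r1: "run In1 ((?J p)(p := cell (cells ?v p))) (p + 1)" using p lx by (subst J) auto
    have i: "nat (p - lx - 1) < length (binary y)" "length (binary y) - 1 - nat (p - lx - 1) = nat (H - 1 - p)"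
      "nat p = length (binary x) + Suc (nat (p - lx - 1))"
      using p x y lx by auto
    have "?J p p = ?w ! nat p" using p lx len by (simp add: tape_of_def)
    also have "\<dots> = binary y ! nat (p - lx - 1)" unfolding i(3) by (simp add: tm_input_def nth_append)
    also have "\<dots> = Digit (bit y (nat (H - 1 - p)))" using binary_nth[OF i(1)] i(2) by simp
    finally have Jp: "?J p p = Digit (bit y (nat (H - 1 - p)))" .
    have c: "cells ?v p = (if bit y (nat (H - 1 - p)) then {1} else {})" using p by (simp add: cells)
    show ?case
      by (rule crun_step[of In1 _ _ _ _ _ _ In1 "cell (cells ?v p)" MRight]) (use r1 p lx c in \<open>auto simp only: Jp cm_delta.simps symbol.case c move_head.simps split: if_splits\<close>)
  qed
  have In0: "run In0 (?J p) p" if "0 \<le> p" "p \<le> lx" for p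
    using that
  proof (induction "nat (lx - p)" arbitrary: p)
    case 0
    then have p: "p = lx" by simp
    have "run In1 (?J (p + 1)) (p + 1)" using p lx by (intro In1) auto
    then have r1: "run In1 ((?J p)(p := cell (cells ?v p))) (p + 1)" using p lx by (subst J) auto
    have c: "cells ?v p = {3}" using p lx ybit[of p] by (simp add: cells)
    have "?J p p = ?w ! nat p" using p lx len by (simp add: tape_of_def)
    then have Jp: "?J p p = Sep" using p x by (simp add: tm_input_def nth_append)
    have "- int m - 1 \<le> p" "p \<le> H" using p lx by auto
    then show ?case
      by (rule_tac crun_step[of In0 _ _ _ _ _ _ In1 "cell (cells ?v p)" MRight]) (use r1 c in \<open>auto simp only: Jp cm_delta.simps symbol.case c move_head.simps\<close>)
  next
    case (Suc k)
    have p: "0 \<le> p" "p < lx" using Suc by auto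
    have "run In0 (?J (p + 1)) (p + 1)" using Suc p by (intro Suc.hyps(1)) auto
    then have r1: "run In0 ((?J p)(p := cell (cells ?v p))) (p + 1)" using p lx by (subst J) auto
    have i: "nat p < length (binary x)" "length (binary x) - 1 - nat p = nat (lx - 1 - p)"
      using p x by auto
    have "?J p p = ?w ! nat p" using p lx len by (simp add: tape_of_def)
    also have "\<dots> = binary x ! nat p" using i by (simp add: tm_input_def nth_append)
    also have "\<dots> = Digit (bit x (nat (lx - 1 - p)))" using binary_nth[OF i(1)] i(2) by simp
    finally have Jp: "?J p p = Digit (bit x (nat (lx - 1 - p)))" .
    have c: "cells ?v p = (if bit x (nat (lx - 1 - p)) then {0} else {})" using p ybit[of p] lx by (simp add: cells)
    show ?case
      by (rule crun_step[of In0 _ _ _ _ _ _ In0 "cell (cells ?v p)" MRight]) (use r1 p lx c in \<open>auto simp only: Jp cm_delta.simps symbol.case c move_head.simps split: if_splits\<close>)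
  qed
  have "?J 0 = tape_of 0 ?w" by (auto simp: fun_eq_iff tape_def tape_of_def)
  with In0[of 0] lx show ?thesis by simp
qed

end

section \<open>Polynomial time bounds\<close>

text \<open>Coefficients may be negative or fractional. Replacing each by a natural number above its
  absolute value leaves a multiple of a single power, which can be compared with a power of
  2.\<close>

lemma poly_bound:
  "\<exists>C k. \<forall>x\<ge>0. poly q x \<le> real C * (1 + x) ^ k" for q :: "real poly"
proof (induction q rule: pCons_induct)
  case 0
  show ?case by (intro exI[of _ 0]) simp
next
  case (pCons a q)
  then obtain C k where C: "\<And>x. x \<ge> 0 \<Longrightarrow> poly q x \<le> real C * (1 + x) ^ k" by blast
  have "poly (pCons a q) x \<le> real (nat \<lceil>\<bar>a\<bar>\<rceil> + C) * (1 + x) ^ Suc k" if x: "x \<ge> 0" for x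
  proof -
    have "a \<le> real (nat \<lceil>\<bar>a\<bar>\<rceil>) * 1" by linarith
    also have "\<dots> \<le> real (nat \<lceil>\<bar>a\<bar>\<rceil>) * (1 + x) ^ Suc k"
      using x by (intro mult_left_mono one_le_power) auto
    finally have a: "a \<le> real (nat \<lceil>\<bar>a\<bar>\<rceil>) * (1 + x) ^ Suc k" .
    have "x * poly q x \<le> x * (real C * (1 + x) ^ k)" using x C by (intro mult_left_mono) auto
    also have "\<dots> \<le> (1 + x) * (real C * (1 + x) ^ k)" using x by (intro mult_right_mono) auto
    finally have "x * poly q x \<le> real C * (1 + x) ^ Suc k" by (simp add: mult_ac)
    with a show ?thesis by (simp add: algebra_simps)
  qed
  then show ?case by blast
qed

lemma poly_poly_bound:
  "\<exists>C k. \<forall>x\<ge>0. \<forall>y\<ge>0. poly (poly p [:y:]) x \<le> real C * ((1 + x) * (1 + y)) ^ k" for p :: "real poly poly"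
proof (induction p rule: pCons_induct)
  case 0
  show ?case by (intro exI[of _ 0]) simp
next
  case (pCons a p)
  then obtain C k where C: "\<And>x y. x \<ge> 0 \<Longrightarrow> y \<ge> 0 \<Longrightarrow> poly (poly p [:y:]) x \<le> real C * ((1 + x) * (1 + y)) ^ k"
    by blast
  obtain D l where D: "\<And>x. x \<ge> 0 \<Longrightarrow> poly a x \<le> real D * (1 + x) ^ l" using poly_bound by blast
  have "poly (poly (pCons a p) [:y:]) x \<le> real (D + C) * ((1 + x) * (1 + y)) ^ Suc (k + l)"
    if x: "x \<ge> 0" and y: "y \<ge> 0" for x y
  proof -
    let ?Z = "(1 + x) * (1 + y)"
    have "1 * 1 \<le> ?Z" "(1 + x) * 1 \<le> ?Z" "1 * (1 + y) \<le> ?Z" using x y by (intro mult_mono; simp)+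
    then have Z: "1 \<le> ?Z" "1 + x \<le> ?Z" "y \<le> ?Z" by auto
    have "poly a x \<le> real D * (1 + x) ^ l" using x by (rule D)
    also have "\<dots> \<le> real D * ?Z ^ l" using x Z by (intro mult_left_mono power_mono) auto
    also have "\<dots> \<le> real D * ?Z ^ Suc (k + l)" using Z by (intro mult_left_mono power_increasing) auto
    finally have a: "poly a x \<le> real D * ?Z ^ Suc (k + l)" .
    have "y * poly (poly p [:y:]) x \<le> y * (real C * ?Z ^ k)" using x y C by (intro mult_left_mono) auto
    also have "\<dots> \<le> ?Z * (real C * ?Z ^ k)" using Z x y by (intro mult_right_mono) auto
    also have "\<dots> = real C * ?Z ^ Suc k" by simp
    also have "\<dots> \<le> real C * ?Z ^ Suc (k + l)" using Z by (intro mult_left_mono power_increasing) auto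
    finally have "y * poly (poly p [:y:]) x \<le> real C * ?Z ^ Suc (k + l)" .
    with a have "poly a x + y * poly (poly p [:y:]) x \<le> real (D + C) * ?Z ^ Suc (k + l)"
      by (simp only: of_nat_add distrib_right)
    then show ?thesis by simp
  qed
  then show ?case by blast
qed

lemma three_counter_imp_linear_space:
  assumes "three_counter_polytime f"
  shows "linear_space_computable f"
proof -
  obtain P r and p :: "real poly poly" where P: "counter_program 3 P" and r: "r < 3"
    and run: "\<And>x y. \<exists>t pc v. cm_halts_in P (0, [x, y, 0]) t (pc, v) \<and> v ! r = f (x, y) \<and>
        real t \<le> poly (poly p [:real y:]) (real x)"
    using assms unfolding three_counter_polytime_def by blast
  obtain C k where C: "\<And>x y. x \<ge> 0 \<Longrightarrow> y \<ge> 0 \<Longrightarrow> poly (poly p [:y:]) x \<le> real C * ((1 + x) * (1 + y)) ^ k"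
    using poly_poly_bound[of p] by blast
  let ?M = "cm_tm P r"
  have "tm_outputs ?M (tm_input x y) (binary (f (x, y))) \<and> finite (tm_cells ?M (tm_input x y)) \<and>
      card (tm_cells ?M (tm_input x y)) \<le> (C + k + 4) * length (tm_input x y)" for x y
  proof -
    let ?lx = "length (binary x)" and ?ly = "length (binary y)"
    define N where "N = length (tm_input x y)"
    define Z where "Z = Suc x * Suc y"
    \<comment> \<open>By \<open>Z \<le> 2 ^ N\<close>, a counter plus the number of steps stays
      below \<open>Suc C * Z ^ Suc k \<le> 2 ^ (C + N * Suc k)\<close>; since
      \<open>1 \<le> N\<close>, the summand \<open>C\<close> is absorbed into
      \<open>N * C\<close>.\<close>
    define m where "m = N * (C + k + 1)"
    have N: "N = ?lx + 1 + ?ly" by (simp add: N_def tm_input_def)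
    obtain t pc v where t: "cm_halts_in P (0, [x, y, 0]) t (pc, v)" "v ! r = f (x, y)"
      "real t \<le> poly (poly p [:real y:]) (real x)"
      using run by blast
    then obtain n where n: "t = Suc n" "(cm_step P ^^ n) (0, [x, y, 0]) (pc, v)" "cm_halted P (pc, v)"
      by (auto simp: cm_halts_in_def)
    have "real t \<le> real C * ((1 + real x) * (1 + real y)) ^ k" using t(3) C by (rule order_trans) simp_all
    also have "\<dots> = real (C * Z ^ k)" by (simp add: Z_def algebra_simps)
    finally have "n < C * Z ^ k" using n(1) by linarith
    have "Z \<le> 2 ^ ?lx * 2 ^ ?ly" unfolding Z_def
      by (intro mult_le_mono Suc_leI less_power_length_binary)
    also have "\<dots> \<le> 2 ^ N" unfolding N by (simp add: power_add)
    finally have ZN: "Z \<le> 2 ^ N" .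
    have Z1: "1 \<le> Z" "x \<le> Z" "y \<le> Z" by (auto simp: Z_def)
    have small: "z + n < 2 ^ m" if "z \<le> Z" for z
    proof -
      have "z \<le> Z ^ Suc k" "Z ^ k \<le> Z ^ Suc k" using that Z1 by (auto intro: le_trans)
      then have "z + n < Z ^ Suc k + C * Z ^ Suc k"
        using \<open>n < C * Z ^ k\<close> mult_le_mono2[of "Z ^ k" "Z ^ Suc k" C] by linarith
      also have "\<dots> = Suc C * Z ^ Suc k" by simp
      also have "\<dots> \<le> 2 ^ C * (2 ^ N) ^ Suc k" by (intro mult_le_mono power_mono ZN) (simp_all add: Suc_le_eq less_exp)
      also have "\<dots> = 2 ^ (C + N * Suc k)" by (simp only: power_add power_mult)
      also have "\<dots> \<le> 2 ^ m" unfolding m_def N by (intro power_increasing) (auto simp: algebra_simps)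
      finally show ?thesis .
    qed
    \<comment> \<open>With cells numbered from 0, the separator stands in cell \<open>?lx\<close>
      and the first blank behind the input is cell \<open>N\<close>.\<close>
    interpret counter_tape P r "int ?lx" "int N" m "binary (f (x, y))"
      by unfold_locales (auto simp: N)
    have "(2::nat) ^ ?ly \<le> 2 ^ N" by (intro power_increasing) (simp_all add: N)
    with less_power_length_binary[of y] have "y < 2 ^ N" by (rule less_le_trans)
    then have fits: "fits ((!) [x, y, 0]) 0"
      using less_power_length_binary[of x]
      by (auto simp: fits_def pos_def numeral_3_eq_3 less_Suc_eq)
    have "\<forall>i<3. [x, y, 0] ! i + n < 2 ^ m"
      using small[of x] small[of y] small[of 0] Z1 by (auto simp: numeral_3_eq_3 less_Suc_eq)
    then have "run (Main 0) (tape ((!) [x, y, 0]) 0) (int N)"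
      using t(2) fits by (intro run_program[OF P r n(2,3)]) auto
    then have "run In0 (tape_of 0 (tm_input x y)) 0"
      by (intro run_input) (auto simp: N)
    note cr = crun_tm[OF this]
    have init: "tm_init ?M (tm_input x y) = (to_nat In0, tape_of 0 (tm_input x y), 0)"
      by (simp add: tm_init_def cm_tm_def)
    have out: "tm_outputs ?M (tm_input x y) (binary (f (x, y)))"
      unfolding tm_outputs_def init using conjunct1[OF cr] .
    have sub: "tm_cells ?M (tm_input x y) \<subseteq> {- int m - 1..int N}"
      using conjunct2[OF cr] unfolding tm_cells_def init N_def by auto
    have "card (tm_cells ?M (tm_input x y)) \<le> card {- int m - 1..int N}"
      by (rule card_mono[OF _ sub]) simp
    also have "\<dots> = m + N + 2" by simp
    \<comment> \<open>\<open>m + N\<close> equals \<open>(C + k + 2) * N\<close>, and the remaining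
      2 is at most \<open>2 * N\<close>.\<close>
    also have "\<dots> \<le> (C + k + 4) * N" by (simp add: m_def N algebra_simps)
    finally show ?thesis using out finite_subset[OF sub] by (simp add: N_def)
  qed
  then show ?thesis
    unfolding linear_space_computable_def using turing_machine_cm_tm[OF P] by blast
qed

theorem theorem1:
  fixes f :: "nat \<times> nat \<Rightarrow> nat"
  shows "three_counter_polytime f \<longleftrightarrow> linear_space_computable f"
  using three_counter_imp_linear_space linear_space_imp_three_counter by blast

end
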